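(* Let $n\ge 5$, let $i,j\in\{1,\dots,n\}$ with $i\neq j$, and let $\mathbf c$ be a real parameter collection satisfying the following two conditions: (1) $c_i^{kj}c_j^{li}\ne c_j^{ki}c_i^{lj}$ for all $k\ne l$ with $k,l\notin\{i,j\}$; (2) for each $p\notin\{i,j\}$ there exist $k,l,m\notin\{i,j\}$ with $k<l<m$ such that $$c_p^{kI}\big(c_i^{lj}c_j^{mi}-c_j^{li}c_i^{mj}\big)+c_p^{lI}\big(c_j^{ki}c_i^{mj}-c_i^{kj}c_j^{mi}\big)+c_p^{mI}\big(c_i^{kj}c_j^{li}-c_j^{ki}c_i^{lj}\big)\ne 0,$$ where $I=i$ or $I=j$. Then for any sufficiently small $t>0$, $\Sigma_{\rm sing}(t\mathbf c)\cap\mathbb P^{n-1}$ contains an algebraic variety of dimension $n-5$.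
   Context: A parameter collection is a family of real numbers $\mathbf c=\{c_i^{kj}\}$, with $i,j,k\in\{1,\dots,n\}$, $k\ne j$, satisfying $c_i^{kj}=c_i^{jk}$ (the index $i$ may coincide with $j$ or $k$). For real $t$ write $t\mathbf c=\{tc_i^{kj}\}_{k\neq j}$. For $\xi=(\xi_1,\dots,\xi_n)\in\mathbb R^n$ the principal symbol is the $n\times n$ matrix $P(\xi,\mathbf c)=(p_{ij})$ with $$p_{ii}=\xi_i+\sum_{k\ne i}c_i^{ki}\xi_k,\qquad p_{ij}=\sum_{k\ne j}c_i^{kj}\xi_k\quad (i\ne j).$$ Set $\Sigma_{\rm sing}(\mathbf c)=\{\xi\in\mathbb R^n\setminus\{0\}: \operatorname{rank}P(\xi,\mathbf c)\le n-2\}$, which is invariant under nonzero real scaling. $\mathbb P^{n-1}$ denotes real projective space, and $\Sigma_{\rm sing}(t\mathbf c)\cap\mathbb P^{n-1}$ denotes the image of $\Sigma_{\rm sing}(t\mathbf c)$ in $\mathbb P^{n-1}$. In condition (2), "$I=i$ or $I=j$" means that the inequality holds for at least one of these two choices of $I$. *)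

theory Defs
  imports "HOL-Analysis.Analysis" "HOL-Library.Extended_Nat"
begin

section \<open>Parameter collections and the principal symbol\<close>

text \<open>The index set \<open>{1,\<dots>,n}\<close> is a finite linearly ordered type \<open>'n\<close> with
  \<open>n = CARD('n)\<close>. The real number \<open>c\<^sub>i\<^sup>k\<^sup>j\<close> is written \<open>c i k j\<close>. Only the values with
  \<open>k \<noteq> j\<close> belong to the collection; the values \<open>c i k k\<close> are never used.\<close>

type_synonym 'n params = "'n \<Rightarrow> 'n \<Rightarrow> 'n \<Rightarrow> real"

definition parameter_collection :: "'n params \<Rightarrow> bool" where
  "parameter_collection c \<longleftrightarrow> (\<forall>i k j. k \<noteq> j \<longrightarrow> c i k j = c i j k)"

definition scale_params :: "real \<Rightarrow> 'n params \<Rightarrow> 'n params" where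
  "scale_params t c = (\<lambda>i k j. t * c i k j)"

definition principal_symbol :: "real ^ 'n \<Rightarrow> 'n params \<Rightarrow> real ^ 'n ^ 'n" where
  "principal_symbol \<xi> c = (\<chi> i j.
     if i = j then \<xi> $ i + (\<Sum>k\<in>UNIV - {i}. c i k i * \<xi> $ k)
     else (\<Sum>k\<in>UNIV - {j}. c i k j * \<xi> $ k))"

text \<open>The bound \<open>rank \<le> n - 2\<close> is written without truncated subtraction.\<close>

definition Sigma_sing :: "'n params \<Rightarrow> (real ^ 'n) set" where
  "Sigma_sing c = {\<xi>. \<xi> \<noteq> 0 \<and> rank (principal_symbol \<xi> c) + 2 \<le> CARD('n)}"

section \<open>Real projective space and its Zariski topology\<close>

text \<open>Points of the projective space of \<open>'a\<close> are the lines through the origin; for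
  \<open>'a = real ^ 'n\<close> this is the real projective space of dimension \<open>n - 1\<close>.\<close>

definition proj_point :: "'a::real_vector \<Rightarrow> 'a set" where
  "proj_point x = span {x}"

definition proj_space :: "'a::real_vector set set" where
  "proj_space = proj_point ` (UNIV - {0})"

text \<open>Forms are represented by polynomial functions. As the ground field is infinite, a
  polynomial is homogeneous of degree \<open>d\<close> (or zero) iff its function satisfies the scaling
  identity below.\<close>

definition homogeneous_form :: "nat \<Rightarrow> ('a::real_normed_vector \<Rightarrow> real) \<Rightarrow> bool" where
  "homogeneous_form d f \<longleftrightarrow>
     real_polynomial_function f \<and> (\<forall>a x. f (a *\<^sub>R x) = a ^ d * f x)"

definition proj_zero_locus :: "('a::real_normed_vector \<Rightarrow> real) set \<Rightarrow> 'a set set" where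
  "proj_zero_locus F = {L \<in> proj_space. \<forall>f\<in>F. \<forall>x\<in>L. f x = 0}"

definition zariski_closed :: "'a::real_normed_vector set set \<Rightarrow> bool" where
  "zariski_closed Z \<longleftrightarrow>
     (\<exists>F. (\<forall>f\<in>F. \<exists>d. homogeneous_form d f) \<and> Z = proj_zero_locus F)"

text \<open>A projective algebraic variety is an irreducible Zariski closed set of real points; as
  usual, the empty set is not irreducible.\<close>

definition projective_variety :: "'a::real_normed_vector set set \<Rightarrow> bool" where
  "projective_variety V \<longleftrightarrow> zariski_closed V \<and> V \<noteq> {} \<and>
     (\<forall>A B. zariski_closed A \<and> zariski_closed B \<and> V = A \<union> B \<longrightarrow> V = A \<or> V = B)"

text \<open>The dimension is the Krull dimension for the Zariski topology: the supremum of the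
  lengths \<open>d\<close> of chains \<open>Z 0 \<subset> \<dots> \<subset> Z d\<close> of irreducible closed subsets. (The
  supremum over no chains at all is \<open>0\<close>, so this is meaningful for nonempty sets only.)\<close>

definition variety_dim :: "'a::real_normed_vector set set \<Rightarrow> enat" where
  "variety_dim V = Sup {enat d | d. \<exists>Z :: nat \<Rightarrow> 'a set set.
     (\<forall>r\<le>d. projective_variety (Z r) \<and> Z r \<subseteq> V) \<and> (\<forall>r<d. Z r \<subset> Z (Suc r))}"

end

theory Submission
  imports Defs "HOL-Library.Function_Algebras" "HOL-Computational_Algebra.Polynomial"
begin

text \<open>Near \<open>t = 0\<close> the symbol is \<open>diag \<xi> + t C(\<xi>)\<close> with \<open>C\<close> linear in \<open>\<xi>\<close>. Choose \<open>\<xi>\<^sub>i\<close> and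
  \<open>\<xi>\<^sub>j\<close> of order \<open>t\<close> and the other coordinates of order \<open>1\<close>. The block of the other indices is
  then invertible, and to leading order the symbol has corank two iff four equations hold: the two
  diagonal ones determine \<open>\<xi>\<^sub>i / t\<close> and \<open>\<xi>\<^sub>j / t\<close>, and the two off-diagonal ones are the linear
  equations \<open>\<Sum> c\<^sub>i\<^sup>k\<^sup>j \<xi>\<^sub>k = 0\<close> and \<open>\<Sum> c\<^sub>j\<^sup>k\<^sup>i \<xi>\<^sub>k = 0\<close> in the \<open>n - 2\<close> coordinates
  other than \<open>i, j\<close>. All \<open>2 \<times> 2\<close> minors of these two equations are nonzero, so they have a solution
  without zero coordinates (\<open>generic_common_zero\<close>), and any two of the coordinates can be solved
  for in terms of the other \<open>n - 4\<close>.

  To pass from \<open>t = 0\<close> to small \<open>t > 0\<close>, two kernel vectors \<open>e\<^sub>i + t V\<close> and \<open>e\<^sub>j + t W\<close>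
  are taken as further unknowns. After division by \<open>t\<close> the whole system is polynomial in all
  unknowns and in \<open>t\<close>, and its derivative at the solution for \<open>t = 0\<close> is invertible
  (\<open>kernel_trivial\<close>). The open mapping property at a point then gives, for all small \<open>t\<close>, a
  singular point \<open>\<xi>\<close> in a fixed compact set with \<open>n - 4\<close> coordinates prescribed arbitrarily in a
  fixed ball (\<open>eventually_covers_singular_locus\<close>).

  It remains to extract a variety of the exact dimension. The singular locus is Zariski closed,
  being cut out by the minors of order \<open>n - 1\<close>. A closed set in which \<open>m + 1\<close> coordinates can
  be prescribed in a ball contains a chain of \<open>m + 1\<close> irreducible closed sets: a minimal closed
  subset with this property is irreducible, as a ball is not the union of two closed sets without
  interior, and a hyperplane section of it has the property for \<open>m\<close> coordinates
  (\<open>covers_imp_irreducible_chain\<close>). Finally, an irreducible closed set that is minimal among those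
  containing a chain of length \<open>m\<close> has dimension exactly \<open>m\<close>. Minimal closed sets exist
  because the Zariski topology is Noetherian, which is Hilbert's basis theorem for the ring of
  polynomial functions.\<close>

section \<open>Hilbert's basis theorem for rings of functions\<close>

text \<open>Subrings and ideals are subsets of one ambient ring, so that a ring generated by finitely many
  elements is reached by adjoining them one by one inside a single type.\<close>

definition is_subring :: "'a::comm_ring_1 set \<Rightarrow> bool" where
  "is_subring R \<longleftrightarrow> 1 \<in> R \<and> (\<forall>a\<in>R. \<forall>b\<in>R. a - b \<in> R \<and> a * b \<in> R)"

definition ideal_of :: "'a::comm_ring_1 set \<Rightarrow> 'a set \<Rightarrow> bool" where
  "ideal_of R I \<longleftrightarrow> I \<subseteq> R \<and> 0 \<in> I \<and> (\<forall>a\<in>I. \<forall>b\<in>I. a - b \<in> I) \<and> (\<forall>r\<in>R. \<forall>a\<in>I. r * a \<in> I)"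

definition noetherian :: "'a::comm_ring_1 set \<Rightarrow> bool" where
  "noetherian R \<longleftrightarrow> (\<forall>I :: nat \<Rightarrow> 'a set. (\<forall>k. ideal_of R (I k)) \<and> mono I
      \<longrightarrow> (\<exists>N. \<forall>k\<ge>N. I k = I N))"

definition polys_over :: "'a::comm_ring_1 set \<Rightarrow> 'a poly set" where
  "polys_over R = {p. \<forall>k. coeff p k \<in> R}"

definition adjoin :: "'a::comm_ring_1 set \<Rightarrow> 'a \<Rightarrow> 'a set" where
  "adjoin R x = (\<lambda>p. poly p x) ` polys_over R"

lemma subringD:
  assumes "is_subring R"
  shows "1 \<in> R" "0 \<in> R" "a \<in> R \<Longrightarrow> b \<in> R \<Longrightarrow> a - b \<in> R" "a \<in> R \<Longrightarrow> b \<in> R \<Longrightarrow> a + b \<in> R"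
    "a \<in> R \<Longrightarrow> b \<in> R \<Longrightarrow> a * b \<in> R"
proof -
  have d: "a - b \<in> R" if "a \<in> R" "b \<in> R" for a b
    using assms that by (auto simp: is_subring_def)
  show 1: "1 \<in> R" using assms by (auto simp: is_subring_def)
  then show 0: "0 \<in> R" using d[of 1 1] by simp
  show "a \<in> R \<Longrightarrow> b \<in> R \<Longrightarrow> a - b \<in> R" by (rule d)
  show "a \<in> R \<Longrightarrow> b \<in> R \<Longrightarrow> a + b \<in> R" using d[of a "0 - b"] d[OF 0, of b] by simp
  show "a \<in> R \<Longrightarrow> b \<in> R \<Longrightarrow> a * b \<in> R" using assms by (auto simp: is_subring_def)
qed

lemma subring_sum:
  assumes "is_subring R" "\<And>k. k \<in> A \<Longrightarrow> f k \<in> R"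
  shows "sum f A \<in> R"
  using assms(2) by (induction A rule: infinite_finite_induct) (auto simp: subringD[OF assms(1)])

lemma subring_polys_over:
  assumes "is_subring R"
  shows "is_subring (polys_over R)"
  unfolding is_subring_def polys_over_def
  using subringD[OF assms] by (auto simp: coeff_mult intro!: subring_sum[OF assms] split: if_splits)

lemma polys_over_monom: "is_subring R \<Longrightarrow> a \<in> R \<Longrightarrow> monom a d \<in> polys_over R"
  using subringD[of R] by (auto simp: polys_over_def)

lemma subring_adjoin:
  assumes "is_subring R"
  shows "is_subring (adjoin R x)"
proof -
  note P = subringD[OF subring_polys_over[OF assms]]
  show ?thesis
    unfolding is_subring_def adjoin_def
  proof (intro conjI ballI)
    show "1 \<in> (\<lambda>p. poly p x) ` polys_over R"
      by (rule image_eqI[of _ _ 1]) (use P in auto)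
    fix a b assume "a \<in> (\<lambda>p. poly p x) ` polys_over R" "b \<in> (\<lambda>p. poly p x) ` polys_over R"
    then obtain p q where pq: "p \<in> polys_over R" "q \<in> polys_over R" "a = poly p x" "b = poly q x"
      by auto
    show "a - b \<in> (\<lambda>p. poly p x) ` polys_over R"
      by (rule image_eqI[of _ _ "p - q"]) (use P pq in auto)
    show "a * b \<in> (\<lambda>p. poly p x) ` polys_over R"
      by (rule image_eqI[of _ _ "p * q"]) (use P pq in auto)
  qed
qed

lemma adjoin_superset:
  assumes "is_subring R"
  shows "R \<subseteq> adjoin R x" "x \<in> adjoin R x"
proof -
  show "R \<subseteq> adjoin R x"
  proof
    fix a assume "a \<in> R"
    then show "a \<in> adjoin R x" unfolding adjoin_def
      by (intro image_eqI[of _ _ "monom a 0"]) (auto simp: poly_monom polys_over_monom[OF assms])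
  qed
  show "x \<in> adjoin R x" unfolding adjoin_def
    by (intro image_eqI[of _ _ "monom 1 1"])
       (auto simp: poly_monom polys_over_monom[OF assms] subringD[OF assms])
qed

text \<open>The coefficient in degree \<open>d\<close> may vanish: \<open>d\<close> only bounds the degree. This makes the
  set an ideal and makes it increase with \<open>d\<close>. Since \<open>x\<close> may be algebraic over \<open>R\<close>, the set
  is defined by representing polynomials and not by elements of the ring that \<open>x\<close> generates.\<close>

definition leading_ideal :: "'a::comm_ring_1 set \<Rightarrow> 'a \<Rightarrow> 'a set \<Rightarrow> nat \<Rightarrow> 'a set" where
  "leading_ideal R x I d =
     (\<lambda>p. coeff p d) ` {p \<in> polys_over R. degree p \<le> d \<and> poly p x \<in> I}"

lemma leading_ideal_is_ideal:
  assumes R: "is_subring R" and I: "ideal_of (adjoin R x) I"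
  shows "ideal_of R (leading_ideal R x I d)"
proof -
  note P = subringD[OF subring_polys_over[OF R]]
  have I0: "0 \<in> I" and Id: "\<And>a b. a \<in> I \<Longrightarrow> b \<in> I \<Longrightarrow> a - b \<in> I"
    and Im: "\<And>r a. r \<in> R \<Longrightarrow> a \<in> I \<Longrightarrow> r * a \<in> I"
    using I adjoin_superset[OF R, of x] by (auto simp: ideal_of_def)
  show ?thesis
    unfolding ideal_of_def
  proof (intro conjI ballI)
    show "leading_ideal R x I d \<subseteq> R" by (auto simp: leading_ideal_def polys_over_def)
    show "0 \<in> leading_ideal R x I d"
      unfolding leading_ideal_def by (rule image_eqI[of _ _ 0]) (use P I0 in auto)
  next
    fix a b assume "a \<in> leading_ideal R x I d" "b \<in> leading_ideal R x I d"
    then obtain p q where pq: "p \<in> polys_over R" "q \<in> polys_over R" "degree p \<le> d" "degree q \<le> d"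
      "poly p x \<in> I" "poly q x \<in> I" "a = coeff p d" "b = coeff q d"
      by (auto simp: leading_ideal_def)
    then show "a - b \<in> leading_ideal R x I d"
      unfolding leading_ideal_def
      by (intro image_eqI[of _ _ "p - q"]) (use P Id in \<open>auto intro: degree_diff_le\<close>)
  next
    fix r a assume r: "r \<in> R" and "a \<in> leading_ideal R x I d"
    then obtain p where p: "p \<in> polys_over R" "degree p \<le> d" "poly p x \<in> I" "a = coeff p d"
      by (auto simp: leading_ideal_def)
    have "smult r p \<in> polys_over R"
      using p r subringD[OF R] by (auto simp: polys_over_def)
    then show "r * a \<in> leading_ideal R x I d"
      unfolding leading_ideal_def using p r Im
      by (intro image_eqI[of _ _ "smult r p"]) (auto intro: order_trans[OF degree_smult_le])
  qed
qed

lemma leading_ideal_mono: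
  "I \<subseteq> J \<Longrightarrow> leading_ideal R x I d \<subseteq> leading_ideal R x J d"
  by (auto simp: leading_ideal_def)

lemma leading_ideal_mono_degree:
  assumes R: "is_subring R" and I: "ideal_of (adjoin R x) I" and "d \<le> e"
  shows "leading_ideal R x I d \<subseteq> leading_ideal R x I e"
  using \<open>d \<le> e\<close>
proof (induction rule: dec_induct)
  case (step m)
  have "leading_ideal R x I m \<subseteq> leading_ideal R x I (Suc m)"
  proof
    fix a assume "a \<in> leading_ideal R x I m"
    then obtain p where p: "p \<in> polys_over R" "degree p \<le> m" "poly p x \<in> I" "a = coeff p m"
      by (auto simp: leading_ideal_def)
    have "x * poly p x \<in> I"
      using I p(3) adjoin_superset[OF R, of x] by (auto simp: ideal_of_def)
    moreover have "pCons 0 p \<in> polys_over R"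
      using p(1) subringD[OF R] by (auto simp: polys_over_def coeff_pCons split: nat.splits)
    ultimately show "a \<in> leading_ideal R x I (Suc m)"
      unfolding leading_ideal_def using p
      by (intro image_eqI[of _ _ "pCons 0 p"]) (auto simp: degree_pCons_eq_if)
  qed
  with step show ?case by blast
qed simp

text \<open>An element of \<open>J\<close> is reduced modulo \<open>I\<close>: subtracting an element of \<open>I\<close> with the same
  leading coefficient lowers the degree of the representing polynomial.\<close>

lemma ideal_eq_if_leading_ideals_eq:
  assumes R: "is_subring R" and I: "ideal_of (adjoin R x) I" and J: "ideal_of (adjoin R x) J"
    and IJ: "I \<subseteq> J" and L: "\<And>d. leading_ideal R x J d \<subseteq> leading_ideal R x I d"
  shows "I = J"
proof -
  note P = subringD[OF subring_polys_over[OF R]]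
  have Iadd: "\<And>a b. a \<in> I \<Longrightarrow> b \<in> I \<Longrightarrow> a + b \<in> I"
  proof -
    fix a b assume "a \<in> I" "b \<in> I"
    moreover from this have "0 - b \<in> I" using I unfolding ideal_of_def by blast
    ultimately have "a - (0 - b) \<in> I" using I unfolding ideal_of_def by blast
    then show "a + b \<in> I" by simp
  qed
  have Jd: "\<And>a b. a \<in> J \<Longrightarrow> b \<in> J \<Longrightarrow> a - b \<in> J"
    using J by (auto simp: ideal_of_def)
  have low: "\<exists>q \<in> polys_over R. degree q \<le> d \<and> poly q x \<in> I \<and> coeff (p - q) d = 0"
    if "p \<in> polys_over R" "degree p \<le> d" "poly p x \<in> J" for p d
  proof -
    have "coeff p d \<in> leading_ideal R x J d" using that by (auto simp: leading_ideal_def)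
    then have "coeff p d \<in> leading_ideal R x I d" using L by blast
    then show ?thesis by (auto simp: leading_ideal_def)
  qed
  have "poly p x \<in> I" if "p \<in> polys_over R" "degree p \<le> d" "poly p x \<in> J" for p d
    using that
  proof (induction d arbitrary: p)
    case 0
    then obtain q where q: "q \<in> polys_over R" "degree q \<le> 0" "poly q x \<in> I" "coeff (p - q) 0 = 0"
      using low by blast
    have "degree (p - q) = 0" using 0 q degree_diff_le[of p 0 q] by simp
    then have "p - q = 0" using q(4) by (metis leading_coeff_0_iff)
    then show ?case using q by simp
  next
    case (Suc d)
    then obtain q where q: "q \<in> polys_over R" "degree q \<le> Suc d" "poly q x \<in> I"
      "coeff (p - q) (Suc d) = 0"
      using low by blast
    have "degree (p - q) \<le> Suc d" using Suc q by (auto intro: degree_diff_le)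
    with q(4) have "degree (p - q) \<le> d"
      by (metis coeff_0_degree_minus_1 degree_0 diff_Suc_1 diff_le_mono le_SucE leading_coeff_0_iff zero_le)
    moreover have "poly (p - q) x \<in> J" using Suc.prems q IJ Jd by auto
    ultimately have "poly (p - q) x \<in> I" using Suc.IH Suc.prems q P by blast
    then have "poly (p - q) x + poly q x \<in> I" using q Iadd by blast
    then show ?case by simp
  qed
  then have "J \<subseteq> I"
    using J unfolding ideal_of_def adjoin_def by blast
  with IJ show ?thesis by blast
qed

text \<open>Hilbert's basis theorem. The leading ideals \<open>L d k\<close> of a chain of ideals increase in
  the degree \<open>d\<close> and in the position \<open>k\<close> in the chain. The diagonal \<open>L k k\<close> becomes constant
  at some \<open>n\<close>, which settles all degrees \<open>d \<ge> n\<close> at once; each of the finitely many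
  degrees below \<open>n\<close> becomes constant on its own.\<close>

lemma noetherian_adjoin:
  assumes R: "is_subring R" and N: "noetherian R"
  shows "noetherian (adjoin R x)"
  unfolding noetherian_def
proof (intro allI impI, elim conjE)
  fix I :: "nat \<Rightarrow> 'a set"
  assume id: "\<forall>k. ideal_of (adjoin R x) (I k)" and mono: "mono I"
  define L where "L d k = leading_ideal R x (I k) d" for d k
  have Lid: "ideal_of R (L d k)" for d k
    using leading_ideal_is_ideal[OF R] id by (simp add: L_def)
  have Lmono: "L d k \<subseteq> L e m" if "d \<le> e" "k \<le> m" for d e k m
  proof -
    have "L d k \<subseteq> L e k" using leading_ideal_mono_degree[OF R] id that(1) by (auto simp: L_def)
    also have "\<dots> \<subseteq> L e m" unfolding L_def by (rule leading_ideal_mono[OF monoD[OF mono that(2)]])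
    finally show ?thesis .
  qed
  have "mono (\<lambda>k. L k k)" by (auto simp: mono_def intro: Lmono[THEN subsetD])
  then obtain n where n: "\<And>k. k \<ge> n \<Longrightarrow> L k k = L n n"
    using N Lid unfolding noetherian_def by meson
  have "\<exists>M. \<forall>k\<ge>M. L d k = L d M" for d
  proof -
    have "mono (\<lambda>k. L d k)" by (auto simp: mono_def intro: Lmono[THEN subsetD])
    then show ?thesis using N Lid unfolding noetherian_def by meson
  qed
  then obtain M where M: "\<And>d k. k \<ge> M d \<Longrightarrow> L d k = L d (M d)" by metis
  define K where "K = Max (insert n (M ` {..<n}))"
  have Kn: "n \<le> K" and KM: "\<And>d. d < n \<Longrightarrow> M d \<le> K" by (auto simp: K_def)
  have stable: "L d k = L d K" if "k \<ge> K" for d k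
  proof (cases "d < n")
    case True
    then show ?thesis using M[of d k] M[of d K] KM[of d] that by simp
  next
    case False
    have "L d k \<subseteq> L (max d k) (max d k)" by (rule Lmono) auto
    also have "\<dots> = L n n" by (rule n) (use False in auto)
    also have "\<dots> \<subseteq> L d K" by (rule Lmono) (use False Kn in auto)
    finally show ?thesis using Lmono[of d d K k] that by blast
  qed
  have "I k = I K" if "k \<ge> K" for k
    using ideal_eq_if_leading_ideals_eq[OF R, of x "I K" "I k"] id monoD[OF mono that] stable[OF that]
    by (auto simp: L_def)
  then show "\<exists>N. \<forall>k\<ge>N. I k = I N" by blast
qed

definition constants :: "('b \<Rightarrow> real) set" where
  "constants = range (\<lambda>a _. a)"

lemma subring_constants: "is_subring constants"
  unfolding is_subring_def constants_def
  by (auto simp: fun_eq_iff image_iff)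

lemma noetherian_constants: "noetherian constants"
  unfolding noetherian_def
proof (intro allI impI, elim conjE)
  fix I :: "nat \<Rightarrow> ('b \<Rightarrow> real) set"
  assume id: "\<forall>k. ideal_of constants (I k)" and mono: "mono I"
  have dich: "I k = {0} \<or> I k = constants" for k
  proof (cases "I k = {0}")
    case False
    then obtain a where a: "(\<lambda>_. a) \<in> I k" "a \<noteq> 0"
      using id[rule_format, of k] unfolding ideal_of_def constants_def zero_fun_def by fastforce
    have "(\<lambda>_. b) \<in> I k" for b
    proof -
      have "(\<lambda>_. b / a) * (\<lambda>_. a) \<in> I k"
        using id[rule_format, of k] a unfolding ideal_of_def constants_def by blast
      then show ?thesis using a by (simp add: times_fun_def)
    qed
    then show ?thesis using id[rule_format, of k] by (auto simp: ideal_of_def constants_def)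
  qed simp
  show "\<exists>N. \<forall>k\<ge>N. I k = I N"
  proof (cases "\<exists>N. I N = constants")
    case True
    then obtain N where N: "I N = constants" by blast
    have "I k = I N" if "k \<ge> N" for k
      using monoD[OF mono that] N id by (auto simp: ideal_of_def)
    then show ?thesis by blast
  next
    case False
    then show ?thesis using dich by metis
  qed
qed

lemma finitely_generated_noetherian:
  fixes X :: "('b \<Rightarrow> real) set"
  assumes "finite X"
  shows "\<exists>R. is_subring R \<and> noetherian R \<and> constants \<subseteq> R \<and> X \<subseteq> R"
  using assms
proof induction
  case empty
  then show ?case using subring_constants noetherian_constants by blast
next
  case (insert x X)
  then obtain R where "is_subring R" "noetherian R" "constants \<subseteq> R" "X \<subseteq> R" by blast
  then show ?case
    using subring_adjoin[of R x] noetherian_adjoin[of R x] adjoin_superset[of R x]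
    by (intro exI[of _ "adjoin R x"]) auto
qed

lemma sum_fun_apply: "(\<Sum>b\<in>B. F b) x = (\<Sum>b\<in>B. F b x)"
  by (induction B rule: infinite_finite_induct) auto

text \<open>The polynomial functions are generated by the constants and the coordinate functions. An
  inclusion suffices for the descending chain condition on zero sets.\<close>

lemma noetherian_polynomial_functions:
  "\<exists>R :: ('b::euclidean_space \<Rightarrow> real) set.
     is_subring R \<and> noetherian R \<and> {f. real_polynomial_function f} \<subseteq> R"
proof -
  obtain R :: "('b \<Rightarrow> real) set" where R: "is_subring R" "noetherian R" "constants \<subseteq> R"
    and B: "(\<lambda>b x. x \<bullet> b) ` Basis \<subseteq> R"
    using finitely_generated_noetherian[of "(\<lambda>b x. x \<bullet> b) ` (Basis :: 'b set)"] by auto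
  have const: "(\<lambda>x. a) \<in> R" for a using R(3) by (auto simp: constants_def)
  have "f \<in> R" if "real_polynomial_function f" for f
    using that
  proof induction
    case (linear f)
    have "(\<Sum>b\<in>Basis. (\<lambda>x. f b) * (\<lambda>x. x \<bullet> b)) \<in> R"
      using B const by (intro subring_sum R(1) subringD(5)[OF R(1)]) auto
    also have "(\<Sum>b\<in>Basis. (\<lambda>x. f b) * (\<lambda>x. x \<bullet> b)) = f"
    proof
      fix x
      have "f x = f (\<Sum>b\<in>Basis. (x \<bullet> b) *\<^sub>R b)" by (simp add: euclidean_representation)
      also have "\<dots> = (\<Sum>b\<in>Basis. (x \<bullet> b) * f b)"
        using linear by (simp add: linear_sum linear_scale bounded_linear.linear)
      also have "\<dots> = (\<Sum>b\<in>Basis. (\<lambda>x. f b) * (\<lambda>x. x \<bullet> b)) x"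
        by (simp add: sum_fun_apply mult.commute)
      finally show "(\<Sum>b\<in>Basis. (\<lambda>x. f b) * (\<lambda>x. x \<bullet> b)) x = f x" by simp
    qed
    finally show ?case .
  next
    case (const c)
    then show ?case using \<open>(\<lambda>x. c) \<in> R\<close> by simp
  next
    case (add f g)
    then show ?case using subringD(4)[OF R(1), of f g] by (simp add: plus_fun_def)
  next
    case (mult f g)
    then show ?case using subringD(5)[OF R(1), of f g] by (simp add: times_fun_def)
  qed
  then show ?thesis using R by auto
qed

section \<open>The Zariski topology is Noetherian\<close>

lemma proj_point_eq: "proj_point x = range (\<lambda>a. a *\<^sub>R x)"
  by (simp add: proj_point_def span_singleton)

lemma homogeneous_form_vanishes_on_line:
  assumes "homogeneous_form d f"
  shows "(\<forall>y\<in>proj_point x. f y = 0) \<longleftrightarrow> f x = 0"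
proof
  assume "\<forall>y\<in>proj_point x. f y = 0"
  moreover have "x \<in> proj_point x" by (simp add: proj_point_def span_base)
  ultimately show "f x = 0" by blast
next
  assume "f x = 0"
  then show "\<forall>y\<in>proj_point x. f y = 0"
    using assms by (auto simp: proj_point_eq homogeneous_form_def)
qed

lemma proj_point_in_zero_locus:
  assumes "\<forall>f\<in>F. \<exists>d. homogeneous_form d f" "x \<noteq> 0"
  shows "proj_point x \<in> proj_zero_locus F \<longleftrightarrow> (\<forall>f\<in>F. f x = 0)"
  using assms homogeneous_form_vanishes_on_line[of _ _ x]
  unfolding proj_zero_locus_def proj_space_def by blast

lemma zariski_closed_imp_subset: "zariski_closed Z \<Longrightarrow> Z \<subseteq> proj_space"
  by (auto simp: zariski_closed_def proj_zero_locus_def)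

lemma zariski_closed_cut:
  assumes "zariski_closed Z" "homogeneous_form d h"
  shows "zariski_closed {L \<in> Z. \<forall>x\<in>L. h x = 0}"
proof -
  obtain F where F: "\<forall>f\<in>F. \<exists>d. homogeneous_form d f" "Z = proj_zero_locus F"
    using assms(1) by (auto simp: zariski_closed_def)
  have "{L \<in> Z. \<forall>x\<in>L. h x = 0} = proj_zero_locus (insert h F)"
    by (auto simp: F(2) proj_zero_locus_def)
  moreover have "\<forall>f\<in>insert h F. \<exists>d. homogeneous_form d f" using F(1) assms(2) by blast
  ultimately show ?thesis unfolding zariski_closed_def by blast
qed

text \<open>Each set of the chain is the zero set of its ideal of vanishing functions, so a strictly
  descending chain of sets would give a strictly ascending chain of ideals.\<close>

lemma zariski_closed_descending_chain:
  fixes Z :: "nat \<Rightarrow> 'a::euclidean_space set set"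
  assumes closed: "\<And>k. zariski_closed (Z k)" and dec: "\<And>k. Z (Suc k) \<subset> Z k"
  shows False
proof -
  obtain R :: "('a \<Rightarrow> real) set" where R: "is_subring R" "noetherian R"
    and poly: "{f. real_polynomial_function f} \<subseteq> R"
    using noetherian_polynomial_functions by blast
  define I where "I k = {f \<in> R. \<forall>L\<in>Z k. \<forall>x\<in>L. f x = 0}" for k
  have "ideal_of R (I k)" for k
    using subringD[OF R(1)] by (auto simp: ideal_of_def I_def)
  moreover have "mono I"
  proof (rule mono_iff_le_Suc[THEN iffD2], rule allI)
    show "I k \<le> I (Suc k)" for k using dec[of k] by (auto simp: I_def)
  qed
  ultimately obtain N where N: "\<And>k. k \<ge> N \<Longrightarrow> I k = I N"
    using R(2) unfolding noetherian_def by blast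
  obtain F where F: "\<forall>f\<in>F. \<exists>d. homogeneous_form d f" "Z (Suc N) = proj_zero_locus F"
    using closed[of "Suc N"] by (auto simp: zariski_closed_def)
  have "F \<subseteq> I (Suc N)"
    using F poly by (fastforce simp: I_def proj_zero_locus_def homogeneous_form_def)
  then have "F \<subseteq> I N" using N[of "Suc N"] by simp
  then have "Z N \<subseteq> Z (Suc N)"
    using zariski_closed_imp_subset[OF closed[of N]] by (auto simp: F(2) proj_zero_locus_def I_def)
  with dec[of N] show False by blast
qed

lemma zariski_closed_minimal:
  fixes Z :: "'a::euclidean_space set set"
  assumes "zariski_closed Z" "P Z"
  obtains Y where "zariski_closed Y" "P Y" "Y \<subseteq> Z"
    "\<And>X. zariski_closed X \<Longrightarrow> P X \<Longrightarrow> X \<subseteq> Y \<Longrightarrow> X = Y"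
proof -
  let ?r = "{(X, Y :: 'a set set). zariski_closed X \<and> zariski_closed Y \<and> X \<subset> Y}"
  have "wf ?r"
    unfolding wf_iff_no_infinite_down_chain
  proof
    assume "\<exists>f. \<forall>k. (f (Suc k), f k) \<in> ?r"
    then obtain f where "\<And>k. (f (Suc k), f k) \<in> ?r" by blast
    then show False by (intro zariski_closed_descending_chain[of f]) auto
  qed
  moreover have "Z \<in> {X. zariski_closed X \<and> P X \<and> X \<subseteq> Z}" using assms by simp
  ultimately obtain Y where Y: "Y \<in> {X. zariski_closed X \<and> P X \<and> X \<subseteq> Z}"
    and min: "\<And>X. (X, Y) \<in> ?r \<Longrightarrow> X \<notin> {X. zariski_closed X \<and> P X \<and> X \<subseteq> Z}"
    by (rule wfE_min) (rule that)
  show ?thesis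
  proof (rule that)
    show "X = Y" if "zariski_closed X" "P X" "X \<subseteq> Y" for X
      using min[of X] Y that by auto
  qed (use Y in auto)
qed

section \<open>Subvarieties of prescribed dimension\<close>

definition irreducible_chain :: "nat \<Rightarrow> 'a::real_normed_vector set set \<Rightarrow> (nat \<Rightarrow> 'a set set) \<Rightarrow> bool" where
  "irreducible_chain d V Z \<longleftrightarrow>
     (\<forall>r\<le>d. projective_variety (Z r) \<and> Z r \<subseteq> V) \<and> (\<forall>r<d. Z r \<subset> Z (Suc r))"

lemma variety_dim_eq: "variety_dim V = Sup {enat d | d. \<exists>Z. irreducible_chain d V Z}"
  by (simp add: variety_dim_def irreducible_chain_def)

text \<open>Take \<open>W\<close> minimal among the irreducible closed sets that contain a chain of length \<open>m\<close>. A
  longer chain in \<open>W\<close> would have a member of index \<open>m\<close>, properly contained in \<open>W\<close> and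
  itself containing a chain of length \<open>m\<close>.\<close>

lemma exact_dimension_subvariety:
  fixes V :: "'a::euclidean_space set set"
  assumes "zariski_closed V" "irreducible_chain m V Z"
  obtains W where "projective_variety W" "W \<subseteq> V" "variety_dim W = enat m"
proof -
  define P where "P W \<longleftrightarrow> projective_variety W \<and> (\<exists>Z. irreducible_chain m W Z)" for W :: "'a set set"
  have P1: "P (Y m)" if "irreducible_chain d X Y" "m \<le> d" for d X Y
  proof -
    have "Y r \<subseteq> Y m" if "r \<le> m" for r
      using \<open>r \<le> m\<close>
    proof (induction rule: inc_induct)
      case (step n)
      then have "n < d" using \<open>m \<le> d\<close> by simp
      then have "Y n \<subset> Y (Suc n)" using \<open>irreducible_chain d X Y\<close> by (auto simp: irreducible_chain_def)
      then show ?case using step by blast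
    qed simp
    then have "irreducible_chain m (Y m) Y"
      using that by (auto simp: irreducible_chain_def)
    moreover have "projective_variety (Y m)" using that by (auto simp: irreducible_chain_def)
    ultimately show ?thesis unfolding P_def by blast
  qed
  have "P (Z m)" using P1[OF assms(2)] by simp
  moreover have "zariski_closed (Z m)" "Z m \<subseteq> V"
    using assms(2) by (auto simp: irreducible_chain_def projective_variety_def)
  ultimately obtain W where W: "P W" "W \<subseteq> Z m"
    "\<And>X. zariski_closed X \<Longrightarrow> P X \<Longrightarrow> X \<subseteq> W \<Longrightarrow> X = W"
    using zariski_closed_minimal[of "Z m" P] by metis
  have le: "d \<le> m" if "irreducible_chain d W Y" for d Y
  proof (rule ccontr)
    assume "\<not> d \<le> m"
    then have d: "m < d" by simp
    then have "P (Y m)" "Y m \<subset> Y (Suc m)" "Y (Suc m) \<subseteq> W" "zariski_closed (Y m)"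
      using P1[OF that] that by (auto simp: irreducible_chain_def projective_variety_def)
    then show False using W(3)[of "Y m"] by auto
  qed
  obtain Y where Y: "irreducible_chain m W Y" using W(1) by (auto simp: P_def)
  have "variety_dim W = enat m"
    unfolding variety_dim_eq
  proof (rule antisym)
    show "Sup {enat d | d. \<exists>Z. irreducible_chain d W Z} \<le> enat m"
      using le by (auto intro!: Sup_least)
    show "enat m \<le> Sup {enat d | d. \<exists>Z. irreducible_chain d W Z}"
      using Y by (auto intro!: Sup_upper)
  qed
  then show ?thesis using that W \<open>Z m \<subseteq> V\<close> by (auto simp: P_def)
qed

section \<open>Sets with freely prescribed coordinates\<close>

text \<open>The coordinates in \<open>S\<close> of points in the cone over \<open>Z\<close> can be prescribed freely in a
  ball; only the coordinates of \<open>x\<close> in \<open>S\<close> matter. The compact set \<open>K\<close> keeps the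
  solutions bounded and away from the origin, which makes the set of solvable \<open>x\<close> closed.\<close>

definition covers :: "'n::finite set \<Rightarrow> (real ^ 'n) set set \<Rightarrow> bool" where
  "covers S Z \<longleftrightarrow> (\<exists>y \<epsilon> K. \<epsilon> > 0 \<and> compact K \<and> 0 \<notin> K \<and>
     (\<forall>x\<in>ball y \<epsilon>. \<exists>\<xi>\<in>K. proj_point \<xi> \<in> Z \<and> (\<forall>k\<in>S. \<xi> $ k = x $ k)))"

text \<open>The set is the sum of a compact set, the part in \<open>K\<close> of the cone over \<open>Z\<close>, and the closed
  subspace where the coordinates in \<open>S\<close> vanish.\<close>

lemma closed_shadow:
  fixes Z :: "(real ^ 'n) set set"
  assumes "zariski_closed Z" "compact K" "0 \<notin> K"
  shows "closed {x. \<exists>\<xi>\<in>K. proj_point \<xi> \<in> Z \<and> (\<forall>k\<in>S. \<xi> $ k = x $ k)}"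
proof -
  obtain F where F: "\<forall>f\<in>F. \<exists>d. homogeneous_form d f" "Z = proj_zero_locus F"
    using assms(1) by (auto simp: zariski_closed_def)
  define K' where "K' = K \<inter> (\<Inter>f\<in>F. {x. f x = 0})"
  have "closed {x. f x = 0}" if "f \<in> F" for f
  proof -
    have "real_polynomial_function f" using F that by (auto simp: homogeneous_form_def)
    then have "continuous_on UNIV f"
      by (simp add: continuous_on_polymonial_function real_polynomial_function_eq)
    then show ?thesis by (rule closed_Collect_eq) auto
  qed
  then have "compact K'" using assms(2) unfolding K'_def by (intro compact_Int_closed closed_INT) auto
  moreover have "closed {v :: real ^ 'n. \<forall>k\<in>S. v $ k = 0}"
  proof -
    have "closed (\<Inter>k\<in>S. {v :: real ^ 'n. v $ k = 0})"
      by (intro closed_INT ballI closed_Collect_eq continuous_intros)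
    also have "(\<Inter>k\<in>S. {v :: real ^ 'n. v $ k = 0}) = {v. \<forall>k\<in>S. v $ k = 0}" by auto
    finally show ?thesis .
  qed
  ultimately have "closed (\<Union>x\<in>K'. \<Union>v\<in>{v. \<forall>k\<in>S. v $ k = 0}. {x + v})"
    by (rule compact_closed_sums)
  also have "(\<Union>x\<in>K'. \<Union>v\<in>{v. \<forall>k\<in>S. v $ k = 0}. {x + v}) =
      {x. \<exists>\<xi>\<in>K. proj_point \<xi> \<in> Z \<and> (\<forall>k\<in>S. \<xi> $ k = x $ k)}" (is "?A = ?B")
  proof
    show "?A \<subseteq> ?B"
    proof
      fix x assume "x \<in> ?A"
      then obtain \<xi> v where \<xi>: "\<xi> \<in> K'" "\<forall>k\<in>S. v $ k = 0" "x = \<xi> + v" by blast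
      moreover have "\<xi> \<in> K" "proj_point \<xi> \<in> Z"
        using \<xi>(1) proj_point_in_zero_locus[OF F(1), of \<xi>] assms(3) by (auto simp: K'_def F(2))
      ultimately show "x \<in> ?B" by auto
    qed
    show "?B \<subseteq> ?A"
    proof
      fix x assume "x \<in> ?B"
      then obtain \<xi> where \<xi>: "\<xi> \<in> K" "proj_point \<xi> \<in> Z" "\<forall>k\<in>S. \<xi> $ k = x $ k" by blast
      then have "\<xi> \<in> K'"
        using proj_point_in_zero_locus[OF F(1), of \<xi>] assms(3) by (auto simp: K'_def F(2))
      moreover have "x - \<xi> \<in> {v. \<forall>k\<in>S. v $ k = 0}" "x = \<xi> + (x - \<xi>)" using \<xi> by auto
      ultimately show "x \<in> ?A" by blast
    qed
  qed
  finally show ?thesis .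
qed

text \<open>If the closed set of points solvable in \<open>A\<close> does not contain the whole ball, its complement in
  the ball is open and nonempty, and all of that complement is solvable in \<open>B\<close>.\<close>

lemma covers_Un:
  fixes A B :: "(real ^ 'n) set set"
  assumes "covers S (A \<union> B)" "zariski_closed A" "zariski_closed B"
  shows "covers S A \<or> covers S B"
proof -
  obtain y \<epsilon> K where K: "\<epsilon> > 0" "compact K" "0 \<notin> K"
    and c: "\<And>x. x \<in> ball y \<epsilon> \<Longrightarrow> \<exists>\<xi>\<in>K. proj_point \<xi> \<in> A \<union> B \<and> (\<forall>k\<in>S. \<xi> $ k = x $ k)"
    using assms(1) unfolding covers_def by blast
  define sh where "sh Z = {x. \<exists>\<xi>\<in>K. proj_point \<xi> \<in> Z \<and> (\<forall>k\<in>S. \<xi> $ k = x $ k)}" for Z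
  have sub: "ball y \<epsilon> \<subseteq> sh A \<union> sh B"
  proof
    fix x assume "x \<in> ball y \<epsilon>"
    then show "x \<in> sh A \<union> sh B" using c[of x] unfolding sh_def by blast
  qed
  have cov: "covers S Z" if "\<delta> > 0" "ball z \<delta> \<subseteq> sh Z" for Z z \<delta>
    unfolding covers_def
  proof (intro exI conjI ballI)
    show "\<exists>\<xi>\<in>K. proj_point \<xi> \<in> Z \<and> (\<forall>k\<in>S. \<xi> $ k = x $ k)" if "x \<in> ball z \<delta>" for x
      using that \<open>ball z \<delta> \<subseteq> sh Z\<close> unfolding sh_def by blast
  qed (use that K in auto)
  show ?thesis
  proof (cases "ball y \<epsilon> \<subseteq> sh A")
    case True
    then show ?thesis using cov K by blast
  next
    case False
    then obtain z where z: "z \<in> ball y \<epsilon> - sh A" by blast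
    have "open (ball y \<epsilon> - sh A)"
      using closed_shadow[OF assms(2) K(2,3), of S] by (auto simp: sh_def)
    then obtain \<delta> where "\<delta> > 0" "ball z \<delta> \<subseteq> ball y \<epsilon> - sh A"
      using z open_contains_ball by blast
    then show ?thesis using cov[of \<delta> z B] sub by blast
  qed
qed

lemma covers_imp_nonempty: "covers S Z \<Longrightarrow> Z \<noteq> {}"
  unfolding covers_def by (metis centre_in_ball empty_iff)

lemma minimal_covering_irreducible:
  fixes Z :: "(real ^ 'n) set set"
  assumes "zariski_closed Z" "covers S Z"
  obtains Y where "projective_variety Y" "covers S Y" "Y \<subseteq> Z"
proof -
  obtain Y where Y: "zariski_closed Y" "covers S Y" "Y \<subseteq> Z"
    "\<And>X. zariski_closed X \<Longrightarrow> covers S X \<Longrightarrow> X \<subseteq> Y \<Longrightarrow> X = Y"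
    using zariski_closed_minimal[of Z "covers S", OF assms] by blast
  have "projective_variety Y"
    unfolding projective_variety_def
  proof (intro conjI allI impI)
    fix A B assume AB: "zariski_closed A \<and> zariski_closed B \<and> Y = A \<union> B"
    then have "covers S A \<or> covers S B" using covers_Un[of S A B] Y(2) by simp
    then show "Y = A \<or> Y = B" using AB Y(4)[of A] Y(4)[of B] by auto
  qed (use Y covers_imp_nonempty in auto)
  then show ?thesis using Y that by simp
qed

lemma norm_axis_real: "norm (axis k a :: real ^ 'n) = \<bar>a\<bar>"
  by (simp add: norm_eq_sqrt_inner inner_axis_axis)

text \<open>The hyperplane \<open>\<xi>\<^sub>k / \<xi>\<^sub>l = y\<^sub>k / y\<^sub>l\<close> through the center \<open>y\<close> of the ball turns
  the coordinate \<open>k\<close> into a function of the coordinate \<open>l\<close>. It does not contain \<open>Z\<close>, because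
  moving the coordinate \<open>k\<close> alone leaves the hyperplane.\<close>

lemma covers_hyperplane_section:
  fixes Z :: "(real ^ 'n) set set"
  assumes Z: "zariski_closed Z" "covers S Z" and k: "k \<in> S" "l \<in> S" "k \<noteq> l"
  obtains Y where "zariski_closed Y" "covers (S - {k}) Y" "Y \<subset> Z"
proof -
  obtain y0 \<epsilon>0 K where e0: "\<epsilon>0 > 0" and K: "compact K" "0 \<notin> K"
    and c0: "\<And>x. x \<in> ball y0 \<epsilon>0 \<Longrightarrow> \<exists>\<xi>\<in>K. proj_point \<xi> \<in> Z \<and> (\<forall>k\<in>S. \<xi> $ k = x $ k)"
    using Z(2) unfolding covers_def by blast
  \<comment> \<open>The slope \<open>y $ k / y $ l\<close> requires a center off the hyperplane \<open>y $ l = 0\<close>.\<close>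
  obtain y where y: "y \<in> ball y0 \<epsilon>0" "y $ l \<noteq> 0"
  proof (cases "y0 $ l = 0")
    case True
    show ?thesis
      by (rule that[of "y0 + axis l (\<epsilon>0 / 2)"]) (use True e0 in \<open>auto simp: dist_norm norm_axis_real\<close>)
  qed (use that[of y0] e0 in auto)
  obtain \<epsilon> where e: "\<epsilon> > 0" "ball y \<epsilon> \<subseteq> ball y0 \<epsilon>0"
    using y(1) open_ball open_contains_ball by blast
  have c: "\<exists>\<xi>\<in>K. proj_point \<xi> \<in> Z \<and> (\<forall>k\<in>S. \<xi> $ k = x $ k)" if "x \<in> ball y \<epsilon>" for x
    using c0 e(2) that by blast
  define h where "h x = x $ k * y $ l - y $ k * x $ l" for x :: "real ^ 'n"
  have h: "homogeneous_form 1 h"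
    unfolding homogeneous_form_def
  proof (intro conjI allI)
    have "real_polynomial_function (\<lambda>x :: real ^ 'n. x $ m)" for m
      by (intro real_polynomial_function.intros(1) bounded_linear_vec_nth)
    then show "real_polynomial_function h"
      unfolding h_def
      by (intro real_polynomial_function_diff real_polynomial_function.intros(4)
          real_polynomial_function.intros(2))
  qed (simp add: h_def algebra_simps)
  define Y where "Y = {L \<in> Z. \<forall>x\<in>L. h x = 0}"
  have inY: "proj_point \<xi> \<in> Y \<longleftrightarrow> proj_point \<xi> \<in> Z \<and> h \<xi> = 0" for \<xi>
    using homogeneous_form_vanishes_on_line[OF h, of \<xi>] by (auto simp: Y_def)
  have "Y \<noteq> Z"
  proof -
    have "y + axis k (\<epsilon> / 2) \<in> ball y \<epsilon>" using e by (simp add: dist_norm norm_axis_real)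
    then obtain \<xi> where \<xi>: "proj_point \<xi> \<in> Z" "\<forall>m\<in>S. \<xi> $ m = (y + axis k (\<epsilon> / 2)) $ m"
      using c by blast
    have "h \<xi> = \<epsilon> / 2 * y $ l"
      using \<xi>(2) k by (simp add: h_def axis_def algebra_simps)
    moreover have "\<epsilon> / 2 * y $ l \<noteq> 0" using e(1) y(2) by simp
    ultimately have "h \<xi> \<noteq> 0" by argo
    with \<xi>(1) inY show ?thesis by blast
  qed
  moreover have "covers (S - {k}) Y"
  proof -
    \<comment> \<open>Adjusting the coordinate \<open>k\<close> to the hyperplane stretches the distance to \<open>y\<close> by at most \<open>1 + M\<close>.\<close>
    define M where "M = \<bar>y $ k / y $ l\<bar>"
    define \<delta> where "\<delta> = \<epsilon> / (1 + M)"
    have M: "M \<ge> 0" by (simp add: M_def)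
    with e(1) have d: "\<delta> > 0" "(1 + M) * \<delta> = \<epsilon>" by (auto simp: \<delta>_def)
    have "\<exists>\<xi>\<in>K. proj_point \<xi> \<in> Y \<and> (\<forall>m\<in>S - {k}. \<xi> $ m = x $ m)" if x: "x \<in> ball y \<delta>" for x
    proof -
      define u where "u = y $ k / y $ l * x $ l"
      define x' where "x' = (\<chi> m. if m = k then u else x $ m)"
      have "x' - y = (\<chi> m. if m = k then 0 else (x - y) $ m) + axis k (u - y $ k)"
        by (simp add: vec_eq_iff x'_def axis_def)
      then have "norm (x' - y) \<le> norm (\<chi> m. if m = k then 0 else (x - y) $ m) + \<bar>u - y $ k\<bar>"
        using norm_triangle_ineq[of "\<chi> m. if m = k then 0 else (x - y) $ m" "axis k (u - y $ k)"]
        by (simp add: norm_axis_real)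
      also have "norm (\<chi> m. if m = k then 0 else (x - y) $ m) \<le> norm (x - y)"
        by (rule norm_le_componentwise_cart) auto
      also have "u - y $ k = y $ k / y $ l * (x - y) $ l"
        using y by (simp add: u_def field_simps)
      also have "\<bar>y $ k / y $ l * (x - y) $ l\<bar> \<le> M * norm (x - y)"
        unfolding abs_mult M_def by (intro mult_left_mono component_le_norm_cart) auto
      finally have "norm (x' - y) \<le> (1 + M) * norm (x - y)" by (simp add: algebra_simps)
      also have "\<dots> < (1 + M) * \<delta>"
        using x M by (intro mult_strict_left_mono) (auto simp: dist_norm norm_minus_commute)
      finally have "x' \<in> ball y \<epsilon>" using d by (simp add: dist_norm norm_minus_commute)
      then obtain \<xi> where \<xi>: "\<xi> \<in> K" "proj_point \<xi> \<in> Z" "\<forall>m\<in>S. \<xi> $ m = x' $ m" using c by blast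
      moreover have "h \<xi> = 0" using \<xi>(3) k y by (simp add: h_def x'_def u_def)
      ultimately have "proj_point \<xi> \<in> Y" using inY by simp
      moreover have "\<forall>m\<in>S - {k}. \<xi> $ m = x $ m" using \<xi>(3) by (simp add: x'_def)
      ultimately show ?thesis using \<xi>(1) by blast
    qed
    then show ?thesis
      unfolding covers_def by (intro exI[of _ y] exI[of _ \<delta>] exI[of _ K] conjI ballI d(1) K)
  qed
  moreover have "zariski_closed Y" unfolding Y_def by (rule zariski_closed_cut[OF Z(1) h])
  ultimately show ?thesis using that by (auto simp: Y_def)
qed

text \<open>The top of the chain is a minimal closed subset of \<open>Z\<close> in which the coordinates in \<open>S\<close> are
  free. The rest comes from a hyperplane section of it, with one free coordinate less.\<close>

lemma covers_imp_irreducible_chain: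
  fixes Z :: "(real ^ 'n) set set"
  assumes "zariski_closed Z" "covers S Z" "card S = Suc m"
  shows "\<exists>C. irreducible_chain m Z C"
  using assms
proof (induction m arbitrary: S Z)
  case 0
  obtain Y where "projective_variety Y" "Y \<subseteq> Z"
    using minimal_covering_irreducible[OF 0(1,2)] by metis
  then show ?case by (intro exI[of _ "\<lambda>_. Y"]) (auto simp: irreducible_chain_def)
next
  case (Suc m)
  obtain Y where Y: "projective_variety Y" "covers S Y" "Y \<subseteq> Z"
    using minimal_covering_irreducible[OF Suc.prems(1,2)] by metis
  obtain k l where kl: "k \<in> S" "l \<in> S" "k \<noteq> l"
  proof -
    obtain k S' where k: "S = insert k S'" "k \<notin> S'" "card S' = Suc m"
      using Suc.prems(3) card_Suc_eq[of S "Suc m"] by auto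
    then obtain l where "l \<in> S'" by fastforce
    with k show ?thesis by (intro that[of k l]) auto
  qed
  obtain X where X: "zariski_closed X" "covers (S - {k}) X" "X \<subset> Y"
    using covers_hyperplane_section[OF _ Y(2) kl] Y(1) unfolding projective_variety_def by metis
  have "card (S - {k}) = Suc m" using Suc.prems(3) kl by simp
  then obtain C where C: "irreducible_chain m X C" using Suc.IH X by blast
  have "irreducible_chain (Suc m) Z (C(Suc m := Y))"
    unfolding irreducible_chain_def
  proof (intro conjI allI impI)
    fix r
    show "projective_variety ((C(Suc m := Y)) r)" "(C(Suc m := Y)) r \<subseteq> Z" if "r \<le> Suc m"
      using that C X Y by (auto simp: irreducible_chain_def le_Suc_eq)
    show "(C(Suc m := Y)) r \<subset> (C(Suc m := Y)) (Suc r)" if "r < Suc m"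
    proof (cases "r = m")
      case True
      then show ?thesis using C X by (auto simp: irreducible_chain_def)
    next
      case False
      then show ?thesis using that C by (auto simp: irreducible_chain_def)
    qed
  qed
  then show ?case by blast
qed

section \<open>The singular locus is Zariski closed\<close>

text \<open>The determinant of this matrix is, up to sign, the minor of \<open>A\<close> obtained by deleting row \<open>p\<close>
  and column \<open>q\<close>; in this form no matrices of smaller size are needed.\<close>

definition replace_row :: "'n \<Rightarrow> 'n \<Rightarrow> real ^ 'n ^ 'n \<Rightarrow> real ^ 'n ^ 'n::finite" where
  "replace_row p q A = (\<chi> r. if r = p then axis q 1 else A $ r)"

lemma kernel_imp_det_eq_0:
  fixes M :: "real ^ 'n ^ 'n"
  assumes "M *v u = 0" "u \<noteq> 0"
  shows "det M = 0"
  using assms invertible_det_nz[of M] invertible_left_inverse[of M] matrix_left_invertible_ker[of M]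
  by blast

text \<open>Some nonzero combination of the two kernel vectors has vanishing coordinate \<open>q\<close>, so it is
  also killed by the new row. The normalization of \<open>v\<close> and \<open>w\<close> at \<open>i\<close> and \<open>j\<close> only
  expresses linear independence.\<close>

lemma two_kernel_vectors_imp_minors_0:
  fixes A :: "real ^ 'n ^ 'n"
  assumes v: "A *v v = 0" "v $ i = 1" "v $ j = 0" and w: "A *v w = 0" "w $ i = 0" "w $ j = 1"
  shows "det (replace_row p q A) = 0"
proof -
  define u where "u = (if v $ q = 0 then v else w - (w $ q / v $ q) *\<^sub>R v)"
  have "u $ i \<noteq> 0 \<or> u $ j \<noteq> 0" using v w by (simp add: u_def)
  then have "u \<noteq> 0" by auto
  moreover have "A *v u = 0"
    using v(1) w(1) by (simp add: u_def matrix_vector_mult_diff_distrib matrix_vector_mult_scaleR)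
  then have "A $ r \<bullet> u = 0" for r by (metis matrix_vector_mul_component zero_index)
  moreover have "u $ q = 0" by (simp add: u_def)
  ultimately have "replace_row p q A *v u = 0"
    by (simp add: vec_eq_iff matrix_vector_mul_component replace_row_def inner_axis')
  then show ?thesis using kernel_imp_det_eq_0 \<open>u \<noteq> 0\<close> by blast
qed

text \<open>If the rank is at least \<open>n - 1\<close>, some \<open>n - 1\<close> rows are independent; they do not span the
  space, so some unit vector extends them to a basis, and it is put in place of the remaining row.\<close>

lemma nonzero_minor:
  fixes A :: "real ^ 'n ^ 'n"
  assumes "CARD('n) \<le> Suc (rank A)"
  obtains p q where "det (replace_row p q A) \<noteq> 0"
proof -
  obtain B where B: "B \<subseteq> rows A" "independent B" "rows A \<subseteq> span B" "card B = dim (rows A)"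
    using basis_exists[of "rows A"] by metis
  have rk: "card B = rank A" using B by (simp add: row_rank_def)
  have "\<exists>r. A $ r = b" if "b \<in> B" for b using B(1) that by (auto simp: rows_def row_def)
  then obtain g where g: "\<And>b. b \<in> B \<Longrightarrow> A $ g b = b" by metis
  have "inj_on g B" by (rule inj_on_inverseI[of _ "\<lambda>r. A $ r"]) (rule g)
  then have "CARD('n) - 1 \<le> card (g ` B)" using assms rk by (simp add: card_image)
  then obtain J where J: "J \<subseteq> g ` B" "card J = CARD('n) - 1" 
    by (rule obtain_subset_with_card_n)
  have "card (UNIV - J) = 1" using J by (simp add: card_Diff_subset)
  then obtain p where p: "UNIV - J = {p}" by (auto simp: card_1_singleton_iff)
  have inj: "inj_on (\<lambda>r. A $ r) J"
    by (rule inj_on_inverseI[of _ g]) (use J(1) g in auto)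
  have ind: "independent ((\<lambda>r. A $ r) ` J)"
    by (rule independent_mono[OF B(2)]) (use J(1) g in auto)
  obtain q where q: "axis q 1 \<notin> span ((\<lambda>r. A $ r) ` J)"
  proof (rule ccontr)
    assume "\<not> thesis"
    then have "axis q 1 \<in> span ((\<lambda>r. A $ r) ` J)" for q using that by blast
    then have "Basis \<subseteq> span ((\<lambda>r. A $ r) ` J)" by (auto simp: Basis_vec_def)
    then have "dim (Basis :: (real ^ 'n) set) \<le> card ((\<lambda>r. A $ r) ` J)"
      by (intro dim_le_card) auto
    also have "\<dots> \<le> CARD('n) - 1" using J(2) card_image_le[of J "\<lambda>r. A $ r"] by simp
    finally have "dim (Basis :: (real ^ 'n) set) \<le> CARD('n) - 1" .
    moreover have "dim (Basis :: (real ^ 'n) set) = CARD('n)"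
    proof -
      have "dim (Basis :: (real ^ 'n) set) = dim (span (Basis :: (real ^ 'n) set))"
        by (rule dim_span[symmetric])
      also have "\<dots> = CARD('n)" by (simp only: span_Basis dim_UNIV DIM_cart DIM_real mult_1_right)
      finally show ?thesis .
    qed
    ultimately show False using zero_less_card_finite[where 'a = 'n] by linarith
  qed
  define M where "M = replace_row p q A"
  have rows: "(\<lambda>r. M $ r) ` UNIV = insert (axis q 1) ((\<lambda>r. A $ r) ` J)"
  proof -
    have U: "UNIV = insert p J" "p \<notin> J" using p by auto
    have "(\<lambda>r. M $ r) ` J = (\<lambda>r. A $ r) ` J"
      by (rule image_cong) (use U(2) in \<open>auto simp: M_def replace_row_def\<close>)
    moreover have "M $ p = axis q 1" by (simp add: M_def replace_row_def)
    ultimately show ?thesis unfolding U(1) image_insert by simp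
  qed
  have rows_M: "rows M = insert (axis q 1) ((\<lambda>r. A $ r) ` J)"
    unfolding rows[symmetric] by (auto simp: rows_def row_def)
  have "independent (rows M)"
    unfolding rows_M by (rule independent_insertI[OF q ind])
  moreover have "card (rows M) = CARD('n)"
  proof -
    have "axis q 1 \<notin> (\<lambda>r. A $ r) ` J" using q by (rule contrapos_nn) (rule span_base)
    then have "card (rows M) = Suc (card ((\<lambda>r. A $ r) ` J))"
      unfolding rows_M by (intro card_insert_disjoint) auto
    also have "\<dots> = Suc (CARD('n) - 1)" using J(2) card_image[OF inj] by presburger
    also have "\<dots> = CARD('n)" using zero_less_card_finite[where 'a = 'n] by linarith
    finally show ?thesis .
  qed
  ultimately have "rank M = CARD('n)"
    using dim_eq_card_independent[of "rows M"] row_rank_def[of M] by presburger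
  then have "det M \<noteq> 0" by (simp add: det_eq_0_rank)
  then show ?thesis using that by (simp add: M_def)
qed

lemma principal_symbol_scale: "principal_symbol (a *\<^sub>R \<xi>) c = a *\<^sub>R principal_symbol \<xi> c"
  by (auto simp: principal_symbol_def vec_eq_iff sum_distrib_left algebra_simps intro!: sum.cong)

text \<open>The symbol is linear in \<open>\<xi>\<close>, and all rows but the constant row \<open>p\<close> contribute a factor.\<close>

lemma homogeneous_minor:
  fixes c :: "'n::finite params"
  shows "homogeneous_form (CARD('n) - 1) (\<lambda>\<xi>. det (replace_row p q (principal_symbol \<xi> c)))"
  unfolding homogeneous_form_def
proof (intro conjI allI)
  have coord: "real_polynomial_function (\<lambda>x :: real ^ 'n. x $ k)" for k
    by (intro real_polynomial_function.intros(1) bounded_linear_vec_nth)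
  have "real_polynomial_function (\<lambda>\<xi>. replace_row p q (principal_symbol \<xi> c) $ r $ s)" for r s
  proof -
    have "real_polynomial_function (\<lambda>\<xi>. \<Sum>k\<in>K. b k * \<xi> $ k)" for K and b :: "'n \<Rightarrow> real"
      by (intro real_polynomial_function_sum real_polynomial_function.intros(2,4) coord) simp
    then show ?thesis
      using coord by (cases "r = p"; cases "r = s")
        (simp_all add: replace_row_def principal_symbol_def real_polynomial_function.intros(2,3))
  qed
  then show "real_polynomial_function (\<lambda>\<xi>. det (replace_row p q (principal_symbol \<xi> c)))"
    unfolding det_def
    by (intro real_polynomial_function_sum real_polynomial_function.intros(4) real_polynomial_function.intros(2)
        real_polynomial_function_prod) (auto simp: finite_permutations)
next
  fix a :: real and \<xi> :: "real ^ 'n"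
  have "replace_row p q (principal_symbol (a *\<^sub>R \<xi>) c) =
      (\<chi> r. (if r = p then 1 else a) *s replace_row p q (principal_symbol \<xi> c) $ r)"
    by (simp add: principal_symbol_scale replace_row_def vec_eq_iff)
  then have "det (replace_row p q (principal_symbol (a *\<^sub>R \<xi>) c)) =
      (\<Prod>r\<in>UNIV. if r = p then 1 else a) * det (replace_row p q (principal_symbol \<xi> c))"
    by (simp add: det_rows_mul)
  also have "(\<Prod>r\<in>UNIV. if r = p then 1 else a) = a ^ (CARD('n) - 1)"
  proof -
    have "(\<Prod>r\<in>UNIV. if r = p then 1 else a) = (\<Prod>r\<in>UNIV - {p}. if r = p then 1 else a)"
      by (rule prod.mono_neutral_right) auto
    also have "\<dots> = (\<Prod>r\<in>UNIV - {p}. a)" by (rule prod.cong) auto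
    finally show ?thesis by (simp add: card_Diff_subset)
  qed
  finally show "det (replace_row p q (principal_symbol (a *\<^sub>R \<xi>) c)) =
      a ^ (CARD('n) - 1) * det (replace_row p q (principal_symbol \<xi> c))" .
qed

definition singular_locus :: "'n::finite params \<Rightarrow> (real ^ 'n) set set" where
  "singular_locus c =
     proj_zero_locus (range (\<lambda>(p, q) \<xi>. det (replace_row p q (principal_symbol \<xi> c))))"

lemma zariski_closed_singular_locus:
  fixes c :: "'n::finite params"
  shows "zariski_closed (singular_locus c)"
  unfolding zariski_closed_def singular_locus_def 
proof (intro exI[of _ "range (\<lambda>(p, q) \<xi>. det (replace_row p q (principal_symbol \<xi> c)))"]
    conjI ballI)
  fix f :: "real ^ 'n \<Rightarrow> real"
  assume "f \<in> range (\<lambda>(p, q) \<xi>. det (replace_row p q (principal_symbol \<xi> c)))"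
  then obtain p q where "f = (\<lambda>\<xi>. det (replace_row p q (principal_symbol \<xi> c)))" by auto
  then show "\<exists>d. homogeneous_form d f" using homogeneous_minor[of p q c] by blast
qed (rule refl)

lemma proj_point_in_singular_locus:
  fixes c :: "'n::finite params"
  assumes "\<xi> \<noteq> 0"
  shows "proj_point \<xi> \<in> singular_locus c \<longleftrightarrow>
    (\<forall>p q. det (replace_row p q (principal_symbol \<xi> c)) = 0)"
proof -
  have "\<forall>f\<in>range (\<lambda>(p, q) \<xi>. det (replace_row p q (principal_symbol \<xi> c))). \<exists>d. homogeneous_form d f"
    using homogeneous_minor[of _ _ c] by auto
  from proj_point_in_zero_locus[OF this assms] show ?thesis
    by (auto simp: singular_locus_def)
qed

lemma singular_locus_subset:
  fixes c :: "'n::finite params"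
  shows "singular_locus c \<subseteq> proj_point ` Sigma_sing c"
proof
  fix L assume L: "L \<in> singular_locus c"
  then obtain \<xi> where \<xi>: "L = proj_point \<xi>" "\<xi> \<noteq> 0"
    by (auto simp: singular_locus_def proj_zero_locus_def proj_space_def)
  have "\<xi> \<in> L" using \<xi> by (simp add: proj_point_def span_base)
  then have "det (replace_row p q (principal_symbol \<xi> c)) = 0" for p q
    using L unfolding singular_locus_def proj_zero_locus_def by force
  then have "\<not> CARD('n) \<le> Suc (rank (principal_symbol \<xi> c))"
    using nonzero_minor[of "principal_symbol \<xi> c" False] by auto
  then show "L \<in> proj_point ` Sigma_sing c" using \<xi> by (auto simp: Sigma_sing_def)
qed

section \<open>Two linear equations with nonzero minors\<close>

text \<open>Any three indices \<open>p, k, l\<close> support a solution, the cross product of the two rows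
  restricted to them, and its coordinate at \<open>p\<close> is a nonzero minor. Generic linear combinations of
  these solutions have no zero coordinate.\<close>

lemma generic_common_zero:
  fixes a b :: "'n::finite \<Rightarrow> real"
  assumes Q: "card Q \<ge> 3" and ab: "\<And>k l. k \<in> Q \<Longrightarrow> l \<in> Q \<Longrightarrow> k \<noteq> l \<Longrightarrow> a k * b l \<noteq> b k * a l"
  obtains y :: "real ^ 'n" where "\<And>p. p \<notin> Q \<Longrightarrow> y $ p = 0" "\<And>p. p \<in> Q \<Longrightarrow> y $ p \<noteq> 0"
    "(\<Sum>p\<in>Q. a p * y $ p) = 0" "(\<Sum>p\<in>Q. b p * y $ p) = 0"
proof -
  define W where "W = {y :: real ^ 'n. (\<forall>p. p \<notin> Q \<longrightarrow> y $ p = 0) \<and>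
     (\<Sum>p\<in>Q. a p * y $ p) = 0 \<and> (\<Sum>p\<in>Q. b p * y $ p) = 0}"
  have lin: "w + s *\<^sub>R u \<in> W" if "w \<in> W" "u \<in> W" for w u s
  proof -
    have "(\<Sum>p\<in>Q. e p * (w + s *\<^sub>R u) $ p) = (\<Sum>p\<in>Q. e p * w $ p) + s * (\<Sum>p\<in>Q. e p * u $ p)"
      for e by (simp add: algebra_simps sum.distrib sum_distrib_left)
    then show ?thesis using that by (simp add: W_def)
  qed
  have single: "\<exists>u\<in>W. u $ p \<noteq> 0" if p: "p \<in> Q" for p
  proof -
    have "2 \<le> card (Q - {p})" using Q p by simp
    then obtain T where T: "T \<subseteq> Q - {p}" "card T = 2" by (rule obtain_subset_with_card_n)
    then obtain k l where "T = {k, l}" "k \<noteq> l" by (auto simp: card_2_iff)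
    with T have kl: "k \<in> Q" "l \<in> Q" "k \<noteq> l" "k \<noteq> p" "l \<noteq> p" by auto
    define u :: "real ^ 'n" where "u = axis p (a k * b l - b k * a l) + axis k (a l * b p - b l * a p)
      + axis l (a p * b k - b p * a k)"
    have S: "(\<Sum>q\<in>Q. e q * u $ q) = e p * (a k * b l - b k * a l) + e k * (a l * b p - b l * a p)
      + e l * (a p * b k - b p * a k)" for e
    proof -
      have ax: "(\<Sum>q\<in>Q. e q * axis r z $ q) = e r * z" if "r \<in> Q" for r and z :: real
      proof -
        have "(\<Sum>q\<in>Q. e q * axis r z $ q) = (\<Sum>q\<in>Q. if q = r then e r * z else 0)"
          by (rule sum.cong) (auto simp: axis_def)
        then show ?thesis using that by simp
      qed
      have "(\<Sum>q\<in>Q. e q * u $ q) = (\<Sum>q\<in>Q. e q * axis p (a k * b l - b k * a l) $ q)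
          + (\<Sum>q\<in>Q. e q * axis k (a l * b p - b l * a p) $ q)
          + (\<Sum>q\<in>Q. e q * axis l (a p * b k - b p * a k) $ q)"
        by (simp add: u_def distrib_left sum.distrib)
      then show ?thesis using ax p kl by simp
    qed
    have "(\<Sum>q\<in>Q. a q * u $ q) = 0" "(\<Sum>q\<in>Q. b q * u $ q) = 0"
      unfolding S by (simp_all add: algebra_simps)
    moreover have "\<forall>q. q \<notin> Q \<longrightarrow> u $ q = 0" using p kl by (auto simp: u_def axis_def)
    moreover have "u $ p = a k * b l - b k * a l" using kl by (simp add: u_def axis_def)
    ultimately show ?thesis using ab kl by (intro bexI[of _ u]) (auto simp: W_def)
  qed
  have "\<exists>w\<in>W. \<forall>p\<in>F. w $ p \<noteq> 0" if "F \<subseteq> Q" for F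
    using finite[of F] that
  proof (induction F)
    case empty
    have "0 \<in> W" by (simp add: W_def)
    then show ?case by blast
  next
    case (insert p F)
    then obtain w where w: "w \<in> W" "\<forall>p\<in>F. w $ p \<noteq> 0" by blast
    obtain u where u: "u \<in> W" "u $ p \<noteq> 0" using single insert.prems by blast
    obtain s where s: "s \<notin> (\<lambda>q. - w $ q / u $ q) ` insert p F"
      using ex_new_if_finite[of "(\<lambda>q. - w $ q / u $ q) ` insert p F"] infinite_UNIV_char_0 by auto
    have "(w + s *\<^sub>R u) $ q \<noteq> 0" if q: "q \<in> insert p F" for q
    proof (cases "u $ q = 0")
      case True
      then show ?thesis using u w q by auto
    next
      case False
      have "s \<noteq> - w $ q / u $ q" using s q by blast
      then show ?thesis using False by (auto simp: field_simps add_eq_0_iff)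
    qed
    then show ?case using lin[OF w(1) u(1)] by blast
  qed
  then obtain w where "w \<in> W" "\<forall>p\<in>Q. w $ p \<noteq> 0" by blast
  then show ?thesis by (intro that[of w]) (auto simp: W_def)
qed

section \<open>Solving a system near a solution with invertible derivative\<close>

text \<open>This tests whether \<open>h\<close> lies in the kernel of the derivative by expanding \<open>f\<close> along the
  line in direction \<open>h\<close>, without a formula for the derivative itself.\<close>

lemma derivative_kills_linear_term:
  fixes f :: "'a::real_normed_vector \<Rightarrow> 'b::real_normed_vector"
  assumes f: "(f has_derivative f') (at z)" and \<phi>: "bounded_linear \<phi>" and "f' h = 0"
    and line: "\<And>s. \<phi> (f (z + s *\<^sub>R h)) = a + s * b + s * s * d"
  shows "b = (0::real)"
proof -
  have "((\<lambda>s. z + s *\<^sub>R h) has_derivative (\<lambda>s. s *\<^sub>R h)) (at 0)"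
    by (auto intro!: derivative_eq_intros)
  moreover have "(f has_derivative f') (at (z + 0 *\<^sub>R h))" using f by simp
  ultimately have "(f \<circ> (\<lambda>s. z + s *\<^sub>R h) has_derivative f' \<circ> (\<lambda>s. s *\<^sub>R h)) (at 0)"
    by (rule diff_chain_at)
  then have "((\<lambda>s. \<phi> ((f \<circ> (\<lambda>s. z + s *\<^sub>R h)) s)) has_derivative
      (\<lambda>s. \<phi> ((f' \<circ> (\<lambda>s. s *\<^sub>R h)) s))) (at 0)"
    by (rule bounded_linear.has_derivative[OF \<phi>])
  moreover have "f' (s *\<^sub>R h) = 0" for s
    using linear_scale[OF has_derivative_linear[OF f]] \<open>f' h = 0\<close> by simp
  ultimately have "((\<lambda>s. a + s * b + s * s * d) has_derivative (\<lambda>s. 0)) (at 0)"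
    using linear_0[OF bounded_linear.linear[OF \<phi>]] by (simp add: o_def line)
  moreover have "((\<lambda>s. a + s * b + s * s * d) has_derivative (\<lambda>s. s * b)) (at 0)"
    by (auto intro!: derivative_eq_intros)
  ultimately have "(\<lambda>s. 0) = (\<lambda>s. s * b)" by (rule has_derivative_unique)
  from fun_cong[OF this, of 1] show ?thesis by simp
qed

text \<open>Besides continuity, only differentiability at the one point \<open>z\<close> enters: this is Sussmann's open mapping theorem,
  applied with the inverse of the derivative.\<close>

lemma open_mapping_at_point:
  fixes f :: "'a::euclidean_space \<Rightarrow> 'a"
  assumes cont: "continuous_on UNIV f" and f: "(f has_derivative f') (at z)"
    and ker: "\<And>h. f' h = 0 \<Longrightarrow> h = 0"
  obtains \<delta> where "\<delta> > 0" "ball (f z) \<delta> \<subseteq> f ` ball z 1"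
proof -
  have lin: "linear f'" by (rule has_derivative_linear[OF f])
  then have "inj f'" using ker by (simp add: linear_injective_0)
  then obtain g where g: "linear g" "\<And>x. f' (g x) = x"
    using linear_injective_isomorphism[OF lin] by blast
  have "f z \<in> interior (f ` ball z 1)"
  proof (rule sussmann_open_mapping[OF open_UNIV cont _ f])
    show "bounded_linear g" using g(1) by (simp add: linear_conv_bounded_linear)
    show "f' \<circ> g = id" using g(2) by auto
  qed auto
  then show ?thesis using that by (auto simp: mem_interior)
qed

lemma differentiable_vec_lambda:
  fixes f :: "'a::real_normed_vector \<Rightarrow> 'n::finite \<Rightarrow> real"
  assumes "\<And>p. (\<lambda>x. f x p) differentiable (at z)"
  shows "(\<lambda>x. \<chi> p. f x p) differentiable (at z)"
proof -
  have "(\<lambda>x. \<Sum>p\<in>UNIV. f x p *\<^sub>R (axis p 1 :: real ^ 'n)) differentiable (at z)"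
    by (intro differentiable_sum ballI differentiable_scaleR assms differentiable_const) auto
  moreover have "(\<chi> p. f x p) = (\<Sum>p\<in>UNIV. f x p *\<^sub>R (axis p 1 :: real ^ 'n))" for x
    using basis_expansion[of "\<chi> p. f x p"] by (simp add: scalar_mult_eq_scaleR)
  ultimately show ?thesis by simp
qed

section \<open>The rescaled kernel equations\<close>

text \<open>These are the entries of the matrix \<open>C(\<xi>)\<close> for which the symbol of \<open>t c\<close> is
  \<open>diag \<xi> + t C(\<xi>)\<close>; the diagonal entries \<open>p = q\<close> are included.\<close>

definition off_diagonal :: "'n::finite params \<Rightarrow> real ^ 'n \<Rightarrow> 'n \<Rightarrow> 'n \<Rightarrow> real" where
  "off_diagonal c \<xi> p q = (\<Sum>k\<in>UNIV - {q}. c p k q * \<xi> $ k)"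

lemma principal_symbol_nth:
  "principal_symbol \<xi> (scale_params t c) $ p $ q
     = (if p = q then \<xi> $ p else 0) + t * off_diagonal c \<xi> p q"
  by (simp add: principal_symbol_def scale_params_def off_diagonal_def sum_distrib_left mult.assoc)

lemma off_diagonal_add_scaleR:
  "off_diagonal c (x + s *\<^sub>R y) p q = off_diagonal c x p q + s * off_diagonal c y p q"
  by (simp add: off_diagonal_def algebra_simps sum.distrib sum_distrib_left)

text \<open>The coordinates \<open>i\<close> and \<open>j\<close> of the singular points are of order \<open>t\<close>; \<open>\<zeta>\<close> holds
  their rescaled values.\<close>

definition squeeze :: "'n \<Rightarrow> 'n \<Rightarrow> real \<Rightarrow> real ^ 'n \<Rightarrow> real ^ 'n::finite" where
  "squeeze i j t \<zeta> = (\<chi> p. if p = i \<or> p = j then t * \<zeta> $ p else \<zeta> $ p)"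

text \<open>This is the symbol of \<open>t c\<close> at the squeezed point applied to \<open>e\<^sub>i + t V\<close>, divided
  by \<open>t\<close>, for \<open>V\<close> vanishing at \<open>i\<close> and \<open>j\<close>: see \<open>principal_symbol_mult_residual\<close>. The
  quotient is a polynomial, so it makes sense at \<open>t = 0\<close>.\<close>

definition residual :: "'n::finite params \<Rightarrow> 'n \<Rightarrow> 'n \<Rightarrow> real \<Rightarrow> real ^ 'n \<Rightarrow> real ^ 'n \<Rightarrow> real ^ 'n" where
  "residual c i j t \<zeta> V = (\<chi> p.
     (if p = i then \<zeta> $ i else if p = j then 0 else \<zeta> $ p * V $ p)
     + off_diagonal c (squeeze i j t \<zeta>) p i
     + t * (\<Sum>q\<in>UNIV. off_diagonal c (squeeze i j t \<zeta>) p q * V $ q))"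

lemma squeeze_commute: "squeeze j i t \<zeta> = squeeze i j t \<zeta>"
  by (auto simp: squeeze_def vec_eq_iff)

lemma principal_symbol_mult_residual:
  fixes c :: "'n::finite params"
  assumes "i \<noteq> j" "V $ i = 0" "V $ j = 0"
  shows "principal_symbol (squeeze i j t \<zeta>) (scale_params t c) *v (axis i 1 + t *\<^sub>R V)
           = t *\<^sub>R residual c i j t \<zeta> V"
proof -
  define \<xi> where "\<xi> = squeeze i j t \<zeta>"
  have "(principal_symbol \<xi> (scale_params t c) *v (axis i 1 + t *\<^sub>R V)) $ p
      = t * residual c i j t \<zeta> V $ p" for p
  proof -
    define v where "v = axis i 1 + t *\<^sub>R V"
    have "(principal_symbol \<xi> (scale_params t c) *v v) $ p
        = (\<Sum>q\<in>UNIV. (if p = q then \<xi> $ p * v $ q else 0) + t * off_diagonal c \<xi> p q * v $ q)"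
      unfolding matrix_vector_mult_def by (auto simp: principal_symbol_nth algebra_simps intro!: sum.cong)
    also have "\<dots> = \<xi> $ p * v $ p + t * (\<Sum>q\<in>UNIV. off_diagonal c \<xi> p q * v $ q)"
      by (simp add: sum.distrib sum_distrib_left mult.assoc)
    also have "(\<Sum>q\<in>UNIV. off_diagonal c \<xi> p q * v $ q)
        = (\<Sum>q\<in>UNIV. (if q = i then off_diagonal c \<xi> p i else 0) + t * (off_diagonal c \<xi> p q * V $ q))"
      by (rule sum.cong) (auto simp: v_def axis_def algebra_simps)
    also have "\<dots> = off_diagonal c \<xi> p i + t * (\<Sum>q\<in>UNIV. off_diagonal c \<xi> p q * V $ q)"
      by (simp add: sum.distrib sum_distrib_left)
    also have "\<xi> $ p * v $ p = t * (if p = i then \<zeta> $ i else if p = j then 0 else \<zeta> $ p * V $ p)"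
      using assms by (auto simp: \<xi>_def squeeze_def v_def axis_def)
    finally show ?thesis
      by (simp add: v_def residual_def \<xi>_def distrib_left)
  qed
  then show ?thesis by (simp add: vec_eq_iff \<xi>_def)
qed

text \<open>The second component collects the \<open>n - 4\<close> coordinates to be prescribed. Its four idle slots
  \<open>i, j, k, l\<close> are filled with the coordinates of \<open>V\<close> and \<open>W\<close> that have to vanish, which
  makes the numbers of equations and unknowns equal.\<close>

definition kernel_system ::
  "'n::finite params \<Rightarrow> 'n \<Rightarrow> 'n \<Rightarrow> 'n \<Rightarrow> 'n \<Rightarrow> real \<times> (real ^ 'n) \<times> (real ^ 'n) \<times> (real ^ 'n)
     \<Rightarrow> real \<times> (real ^ 'n) \<times> (real ^ 'n) \<times> (real ^ 'n)" where
  "kernel_system c i j k l z = (case z of (t, \<zeta>, V, W) \<Rightarrow>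
     (t,
      \<chi> p. if p = i then V $ i else if p = j then V $ j
           else if p = k then W $ i else if p = l then W $ j else \<zeta> $ p,
      residual c i j t \<zeta> V,
      residual c j i t \<zeta> W))"

lemma kernel_system_differentiable:
  fixes c :: "'n::finite params"
  shows "kernel_system c i j k l differentiable (at z)"
proof -
  let ?P = "real_polynomial_function ::
    (real \<times> (real ^ 'n) \<times> (real ^ 'n) \<times> (real ^ 'n) \<Rightarrow> real) \<Rightarrow> bool"
  have T: "?P (\<lambda>z. fst z)"
    and Z: "?P (\<lambda>z. fst (snd z) $ p)" and V: "?P (\<lambda>z. fst (snd (snd z)) $ p)"
    and W: "?P (\<lambda>z. snd (snd (snd z)) $ p)" for p
    by (intro real_polynomial_function.intros(1) bounded_linear_compose[OF bounded_linear_vec_nth]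
        bounded_linear_compose[OF bounded_linear_fst] bounded_linear_compose[OF bounded_linear_snd]
        bounded_linear_fst bounded_linear_snd)+
  have If: "?P (\<lambda>z. if b then f z else g z)" if "?P f" "?P g" for b f g
    using that by (cases b) auto
  have S: "?P (\<lambda>z. squeeze i j (fst z) (fst (snd z)) $ p)" for i j p
    unfolding squeeze_def vec_lambda_beta by (intro If real_polynomial_function.intros(4) T Z)
  have O: "?P (\<lambda>z. off_diagonal c (squeeze i j (fst z) (fst (snd z))) p q)" for i j p q
    unfolding off_diagonal_def
    by (intro real_polynomial_function_sum real_polynomial_function.intros(2,4) S) auto
  have R: "?P (\<lambda>z. residual c i j (fst z) (fst (snd z)) (U z) $ p)"
    if U: "\<And>q. ?P (\<lambda>z. U z $ q)" for i j p U
  proof -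
    have "?P (\<lambda>z. if p = i then fst (snd z) $ i else if p = j then 0 else fst (snd z) $ p * U z $ p)"
      by (intro If real_polynomial_function.intros(2,4) Z U)
    then show ?thesis
      unfolding residual_def vec_lambda_beta
      by (intro real_polynomial_function.intros(3,4) real_polynomial_function_sum T O U) auto
  qed
  have diff: "g differentiable (at z)" if "?P g" for g
    using that by (simp add: real_polynomial_function_eq differentiable_at_polynomial_function)
  have X: "?P (\<lambda>z. if p = i then fst (snd (snd z)) $ i else if p = j then fst (snd (snd z)) $ j
      else if p = k then snd (snd (snd z)) $ i else if p = l then snd (snd (snd z)) $ j
      else fst (snd z) $ p)" for p
    by (intro If Z V W)
  have eq: "kernel_system c i j k l = (\<lambda>z. (fst z,
      \<chi> p. if p = i then fst (snd (snd z)) $ i else if p = j then fst (snd (snd z)) $ j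
           else if p = k then snd (snd (snd z)) $ i else if p = l then snd (snd (snd z)) $ j
           else fst (snd z) $ p,
      \<chi> p. residual c i j (fst z) (fst (snd z)) (fst (snd (snd z))) $ p,
      \<chi> p. residual c j i (fst z) (fst (snd z)) (snd (snd (snd z))) $ p))"
    by (rule ext) (simp add: kernel_system_def case_prod_beta)
  show ?thesis
    unfolding eq
    by (intro differentiable_Pair differentiable_vec_lambda diff T X R V W)
qed

section \<open>Singular points for small parameters\<close>

text \<open>The point \<open>y\<close> solves the leading order equations at \<open>t = 0\<close>. The minor allows the
  two off-diagonal equations to be solved for the coordinates \<open>k\<close> and \<open>l\<close>.\<close>

locale generic_point =
  fixes c :: "'n::finite params" and i j k l :: 'n and y :: "real ^ 'n"
  assumes ij: "i \<noteq> j" and kl: "k \<noteq> l" "k \<notin> {i, j}" "l \<notin> {i, j}"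
    and minor: "c i k j * c j l i \<noteq> c j k i * c i l j"
    and y_ij: "y $ i = 0" "y $ j = 0"
    and y_nz: "\<And>p. p \<notin> {i, j} \<Longrightarrow> y $ p \<noteq> 0"
    and y_zero: "off_diagonal c y i j = 0" "off_diagonal c y j i = 0"
begin

text \<open>The values at \<open>i\<close> and \<open>j\<close> solve the two diagonal equations, and the vectors
  \<open>V0 i\<close> and \<open>V0 j\<close> defined next solve the rows other than \<open>i, j\<close> of the kernel equations
  at \<open>t = 0\<close>.\<close>

definition \<zeta>0 :: "real ^ 'n" where
  "\<zeta>0 = (\<chi> p. if p = i \<or> p = j then - off_diagonal c y p p else y $ p)"

definition V0 :: "'n \<Rightarrow> real ^ 'n" where
  "V0 q = (\<chi> p. if p = i \<or> p = j then 0 else - off_diagonal c y p q / y $ p)"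

abbreviation \<Phi> where "\<Phi> \<equiv> kernel_system c i j k l"
abbreviation z0 where "z0 \<equiv> (0 :: real, \<zeta>0, V0 i, V0 j)"

definition X0 :: "real ^ 'n" where
  "X0 = (\<chi> p. if p \<in> {i, j, k, l} then 0 else y $ p)"

lemma squeeze_0: "squeeze i j 0 \<zeta>0 = y"
  using y_ij by (auto simp: squeeze_def \<zeta>0_def vec_eq_iff)

lemma \<zeta>0_nth:
  "\<zeta>0 $ i = - off_diagonal c y i i" "\<zeta>0 $ j = - off_diagonal c y j j"
  "p \<noteq> i \<Longrightarrow> p \<noteq> j \<Longrightarrow> \<zeta>0 $ p = y $ p"
  by (auto simp: \<zeta>0_def)

lemma residual_0: "residual c i j 0 \<zeta>0 (V0 i) = 0" "residual c j i 0 \<zeta>0 (V0 j) = 0"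
  using ij y_zero y_nz
  by (auto simp: vec_eq_iff residual_def squeeze_commute[of j i] squeeze_0 \<zeta>0_nth V0_def)

lemma \<Phi>_z0: "\<Phi> z0 = (0, X0, 0, 0)"
  using residual_0 by (auto simp: kernel_system_def vec_eq_iff X0_def V0_def \<zeta>0_def)

lemma residual_line:
  "residual c i' j' 0 (\<zeta> + s *\<^sub>R z) (V + s *\<^sub>R A) $ p =
     residual c i' j' 0 \<zeta> V $ p
     + s * ((if p = i' then z $ i' else if p = j' then 0 else \<zeta> $ p * A $ p + z $ p * V $ p)
            + off_diagonal c (squeeze i' j' 0 z) p i')
     + s * s * (if p = i' \<or> p = j' then 0 else z $ p * A $ p)"
proof -
  have "squeeze i' j' 0 (\<zeta> + s *\<^sub>R z) = squeeze i' j' 0 \<zeta> + s *\<^sub>R squeeze i' j' 0 z"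
    by (auto simp: squeeze_def vec_eq_iff)
  then show ?thesis by (simp add: residual_def off_diagonal_add_scaleR algebra_simps)
qed

lemma off_diagonal_two_terms:
  assumes "\<And>p. p \<notin> {k, l} \<Longrightarrow> x $ p = 0" "q \<in> {i, j}"
  shows "off_diagonal c x p q = c p k q * x $ k + c p l q * x $ l"
proof -
  have "off_diagonal c x p q = (\<Sum>r\<in>{k, l}. c p r q * x $ r)"
    unfolding off_diagonal_def
    by (rule sum.mono_neutral_right) (use assms kl in auto)
  then show ?thesis using kl by simp
qed

text \<open>At \<open>t = 0\<close> the linearized system is triangular. The two off-diagonal
  equations determine the coordinates \<open>k\<close> and \<open>l\<close> through the nonzero minor;
  the diagonal equations then determine the coordinates \<open>i\<close> and \<open>j\<close>, and every other row \<open>p\<close>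
  determines coordinate \<open>p\<close> of the kernel vectors, with the nonzero factor \<open>y $ p\<close>.\<close>

lemma kernel_trivial:
  assumes f: "(\<Phi> has_derivative f') (at z0)" and h: "f' h = 0"
  shows "h = 0"
proof -
  obtain \<tau> z A B where h_eq: "h = (\<tau>, z, A, B)" by (cases h) auto
  have \<tau>: "\<tau> = 0"
    by (rule derivative_kills_linear_term[OF f bounded_linear_fst h, of 0 _ 0])
       (simp add: h_eq kernel_system_def)
  have line: "\<Phi> (z0 + s *\<^sub>R h) = (0,
      \<chi> p. if p = i then (V0 i + s *\<^sub>R A) $ i else if p = j then (V0 i + s *\<^sub>R A) $ j
           else if p = k then (V0 j + s *\<^sub>R B) $ i else if p = l then (V0 j + s *\<^sub>R B) $ j
           else (\<zeta>0 + s *\<^sub>R z) $ p,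
      residual c i j 0 (\<zeta>0 + s *\<^sub>R z) (V0 i + s *\<^sub>R A),
      residual c j i 0 (\<zeta>0 + s *\<^sub>R z) (V0 j + s *\<^sub>R B))" for s
    by (simp add: h_eq \<tau> kernel_system_def)
  have bl2: "bounded_linear (\<lambda>u :: real \<times> (real ^ 'n) \<times> (real ^ 'n) \<times> (real ^ 'n). fst (snd u) $ p)"
    and bl3: "bounded_linear (\<lambda>u :: real \<times> (real ^ 'n) \<times> (real ^ 'n) \<times> (real ^ 'n). fst (snd (snd u)) $ p)"
    and bl4: "bounded_linear (\<lambda>u :: real \<times> (real ^ 'n) \<times> (real ^ 'n) \<times> (real ^ 'n). snd (snd (snd u)) $ p)"
    for p
    by (intro bounded_linear_compose[OF bounded_linear_vec_nth]
        bounded_linear_compose[OF bounded_linear_fst] bounded_linear_compose[OF bounded_linear_snd]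
        bounded_linear_fst bounded_linear_snd)+
  have X: "(if p = i then A $ i else if p = j then A $ j else if p = k then B $ i
      else if p = l then B $ j else z $ p) = 0" for p
    by (rule derivative_kills_linear_term[OF f bl2[of p] h, of "fst (snd (\<Phi> z0)) $ p" _ 0])
       (simp add: line, simp add: kernel_system_def)
  have A_ij: "A $ i = 0" "A $ j = 0" and B_ij: "B $ i = 0" "B $ j = 0"
    using X[of i] X[of j] X[of k] X[of l] ij kl by auto
  have z_other: "z $ p = 0" if "p \<notin> {i, j, k, l}" for p
    using X[of p] that by simp
  define x where "x = squeeze i j 0 z"
  have G: "(if p = i then z $ i else if p = j then 0 else \<zeta>0 $ p * A $ p + z $ p * V0 i $ p)
      + off_diagonal c x p i = 0" for p
    unfolding x_def
    by (rule derivative_kills_linear_term[OF f bl3[of p] h])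
       (simp only: line fst_conv snd_conv residual_line)
  have H: "(if p = j then z $ j else if p = i then 0 else \<zeta>0 $ p * B $ p + z $ p * V0 j $ p)
      + off_diagonal c x p j = 0" for p
    unfolding x_def
    by (rule derivative_kills_linear_term[OF f bl4[of p] h])
       (simp only: line fst_conv snd_conv residual_line squeeze_commute[of j i])
  have x: "x $ p = 0" if "p \<notin> {k, l}" for p
    using z_other[of p] that by (auto simp: x_def squeeze_def)
  have xk: "x $ k = z $ k" "x $ l = z $ l" using kl by (auto simp: x_def squeeze_def)
  have "c j k i * z $ k + c j l i * z $ l = 0" "c i k j * z $ k + c i l j * z $ l = 0"
    using G[of j] H[of i] ij off_diagonal_two_terms[OF x, of i j] off_diagonal_two_terms[OF x, of j i]
    by (auto simp: xk)
  then have "(c i k j * c j l i - c j k i * c i l j) * z $ k = 0"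
    "(c i k j * c j l i - c j k i * c i l j) * z $ l = 0"
    by algebra+
  then have z_kl: "z $ k = 0" "z $ l = 0" using minor by auto
  then have "x = 0" using x xk by (metis insertE singletonD vec_eq_iff zero_index)
  then have off: "off_diagonal c x p q = 0" for p q by (simp add: off_diagonal_def)
  have "z $ i = 0" "z $ j = 0" using G[of i] H[of j] off by auto
  then have z0: "z $ p = 0" for p using z_kl z_other by (cases "p \<in> {i, j, k, l}") auto
  have "A $ p = 0" "B $ p = 0" if "p \<notin> {i, j}" for p
    using G[of p] H[of p] that y_nz[OF that] by (auto simp: off z0 \<zeta>0_def)
  then have "A $ p = 0" "B $ p = 0" for p using A_ij B_ij by (cases "p \<in> {i, j}"; force)+
  then have "A = 0" "B = 0" by (simp_all add: vec_eq_iff)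
  then show ?thesis using z0 \<tau> by (simp add: h_eq vec_eq_iff zero_prod_def)
qed

lemma solvable_nearby:
  obtains \<delta> where "\<delta> > 0" "ball (0, X0, 0, 0) \<delta> \<subseteq> \<Phi> ` ball z0 1"
proof -
  obtain f' where f': "(\<Phi> has_derivative f') (at z0)"
    using kernel_system_differentiable[of c i j k l z0] unfolding differentiable_def by blast
  have "continuous_on UNIV \<Phi>"
    by (auto intro!: continuous_at_imp_continuous_on differentiable_imp_continuous_within
        kernel_system_differentiable)
  from open_mapping_at_point[OF this f'] kernel_trivial[OF f'] that show ?thesis
    by (metis \<Phi>_z0)
qed

text \<open>The index \<open>q\<close> is one of the prescribed coordinates. Since \<open>y $ q\<close> is nonzero, it keeps
  the solutions away from the origin.\<close>

lemma eventually_covers_singular_locus: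
  assumes q: "q \<notin> {i, j, k, l}"
  shows "\<forall>\<^sub>F t in at_right 0. covers (UNIV - {i, j, k, l}) (singular_locus (scale_params t c))"
proof -
  obtain \<delta> where \<delta>: "\<delta> > 0" "ball (0, X0, 0, 0) \<delta> \<subseteq> \<Phi> ` ball z0 1" by (rule solvable_nearby)
  define \<epsilon> where "\<epsilon> = min (\<delta> / 2) (\<bar>y $ q\<bar> / 2)"
  have yq: "\<bar>y $ q\<bar> > 0" using y_nz[of q] q by simp
  have \<epsilon>: "\<epsilon> > 0" "\<epsilon> \<le> \<delta> / 2" "\<epsilon> \<le> \<bar>y $ q\<bar> / 2" using \<delta>(1) yq by (auto simp: \<epsilon>_def)
  define K where "K = cball (0 :: real ^ 'n) (norm \<zeta>0 + 1) \<inter> {\<xi>. \<bar>y $ q\<bar> / 2 \<le> \<bar>\<xi> $ q\<bar>}"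
  have "closed {\<xi> :: real ^ 'n. \<bar>y $ q\<bar> / 2 \<le> \<bar>\<xi> $ q\<bar>}"
    by (intro closed_Collect_le continuous_intros)
  then have K: "compact K" "0 \<notin> K" using yq by (auto simp: K_def)
  have cov: "covers (UNIV - {i, j, k, l}) (singular_locus (scale_params t c))"
    if t: "0 < t" "t < \<delta> / 2" "t < 1" for t
  proof -
    have "\<exists>\<xi>\<in>K. proj_point \<xi> \<in> singular_locus (scale_params t c) \<and>
        (\<forall>p\<in>UNIV - {i, j, k, l}. \<xi> $ p = x $ p)" if x: "x \<in> ball X0 \<epsilon>" for x
    proof -
      define x' where "x' = (\<chi> p. if p \<in> {i, j, k, l} then 0 else x $ p)"
      have "norm (x' - X0) \<le> norm (x - X0)"
        by (rule norm_le_componentwise_cart) (auto simp: x'_def X0_def)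
      then have "norm (x' - X0) < \<delta> / 2"
        using x \<epsilon> by (auto simp: dist_norm norm_minus_commute)
      then have "norm (t, x' - X0, 0 :: real ^ 'n, 0 :: real ^ 'n) < \<delta>"
        using norm_Pair_le[of t "(x' - X0, 0 :: (real ^ 'n) \<times> (real ^ 'n))"] t
          norm_Pair_le[of "x' - X0" "0 :: (real ^ 'n) \<times> (real ^ 'n)"]
        by (simp add: zero_prod_def)
      moreover have "(t, x', 0, 0) - (0, X0, 0, 0) = (t, x' - X0, 0 :: real ^ 'n, 0 :: real ^ 'n)"
        by (simp add: zero_prod_def)
      ultimately have "(t, x', 0 :: real ^ 'n, 0 :: real ^ 'n) \<in> ball (0, X0, 0, 0) \<delta>"
        unfolding mem_ball by (subst dist_commute) (simp only: dist_norm)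
      then obtain z where z: "z \<in> ball z0 1" "\<Phi> z = (t, x', 0, 0)" using \<delta>(2) by force
      obtain s \<zeta> V W where z_eq: "z = (s, \<zeta>, V, W)" by (cases z) auto
      have s: "s = t" and res: "residual c i j t \<zeta> V = 0" "residual c j i t \<zeta> W = 0"
        and X: "\<And>p. (if p = i then V $ i else if p = j then V $ j else if p = k then W $ i
          else if p = l then W $ j else \<zeta> $ p) = x' $ p"
        using z(2) by (auto simp: z_eq kernel_system_def vec_eq_iff)
      have V: "V $ i = 0" "V $ j = 0" and W: "W $ i = 0" "W $ j = 0"
        using X[of i] X[of j] X[of k] X[of l] ij kl by (auto simp: x'_def)
      have \<zeta>_x: "\<zeta> $ p = x $ p" if "p \<notin> {i, j, k, l}" for p
        using X[of p] that by (simp add: x'_def)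
      define \<xi> where "\<xi> = squeeze i j t \<zeta>"
      have \<xi>_x: "\<xi> $ p = x $ p" if "p \<notin> {i, j, k, l}" for p
        using \<zeta>_x[OF that] that by (simp add: \<xi>_def squeeze_def)
      let ?P = "principal_symbol \<xi> (scale_params t c)"
      have Pv: "?P *v (axis i 1 + t *\<^sub>R V) = 0"
        unfolding \<xi>_def using principal_symbol_mult_residual[OF ij V] res(1) by simp
      have Pw: "?P *v (axis j 1 + t *\<^sub>R W) = 0"
        using principal_symbol_mult_residual[OF ij[symmetric] W(2,1), of t \<zeta> c] res(2)
        by (simp add: \<xi>_def squeeze_commute[of j i])
      have minors: "det (replace_row p q ?P) = 0" for p q
        by (rule two_kernel_vectors_imp_minors_0[where i = i and j = j, OF Pv _ _ Pw])
           (use V W ij in \<open>auto simp: axis_def\<close>)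
      have "norm \<xi> \<le> norm \<zeta>"
        using t by (intro norm_le_componentwise_cart)
          (auto simp: \<xi>_def squeeze_def abs_mult mult_left_le_one_le)
      also have "norm \<zeta> \<le> norm \<zeta>0 + norm (\<zeta> - \<zeta>0)"
        by (metis norm_triangle_sub add.commute)
      also have "norm (\<zeta> - \<zeta>0) \<le> dist z0 z"
      proof -
        have "dist \<zeta>0 \<zeta> \<le> dist (\<zeta>0, V0 i, V0 j) (\<zeta>, V, W)"
          using dist_fst_le[of "(\<zeta>0, V0 i, V0 j)" "(\<zeta>, V, W)"] by simp
        also have "\<dots> \<le> dist z0 z" using dist_snd_le[of z0 z] by (simp add: z_eq)
        finally show ?thesis by (simp add: dist_norm norm_minus_commute)
      qed
      also have "dist z0 z \<le> 1" using z(1) by simp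
      finally have "norm \<xi> \<le> norm \<zeta>0 + 1" by simp
      moreover have "\<bar>y $ q\<bar> / 2 \<le> \<bar>\<xi> $ q\<bar>"
      proof -
        have "\<bar>(x - X0) $ q\<bar> < \<epsilon>"
          using component_le_norm_cart[of "x - X0" q] x by (simp add: dist_norm norm_minus_commute)
        then show ?thesis using \<epsilon>(3) q \<xi>_x[OF q] by (simp add: X0_def)
      qed
      ultimately have "\<xi> \<in> K" by (simp add: K_def)
      then have "\<xi> \<noteq> 0" using K(2) by auto
      then have "proj_point \<xi> \<in> singular_locus (scale_params t c)"
        using minors by (simp add: proj_point_in_singular_locus)
      then show ?thesis using \<open>\<xi> \<in> K\<close> \<xi>_x by blast
    qed
    then show ?thesis
      unfolding covers_def by (intro exI[of _ X0] exI[of _ \<epsilon>] exI[of _ K] conjI ballI \<epsilon>(1) K)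
  qed
  have "\<forall>\<^sub>F t in at_right (0::real). 0 < t \<and> t < min (\<delta> / 2) 1"
    unfolding eventually_at_right_field using \<delta>(1) by (intro exI[of _ "min (\<delta> / 2) 1"]) auto
  then show ?thesis by (rule eventually_mono) (use cov in auto)
qed

end

theorem theorem4p5:
  fixes c :: "'n::{finite,linorder} params" and i j :: 'n
  assumes "CARD('n) \<ge> 5"
    and "i \<noteq> j"
    and "parameter_collection c"
    and "\<forall>k l. k \<noteq> l \<and> k \<notin> {i, j} \<and> l \<notin> {i, j} \<longrightarrow>
           c i k j * c j l i \<noteq> c j k i * c i l j"
    and "\<forall>p. p \<notin> {i, j} \<longrightarrow>
           (\<exists>k l m. k \<notin> {i, j} \<and> l \<notin> {i, j} \<and> m \<notin> {i, j} \<and> k < l \<and> l < m \<and>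
             (\<exists>I\<in>{i, j}.
                c p k I * (c i l j * c j m i - c j l i * c i m j)
              + c p l I * (c j k i * c i m j - c i k j * c j m i)
              + c p m I * (c i k j * c j l i - c j k i * c i l j) \<noteq> 0))"
  shows "\<forall>\<^sub>F t in at_right (0::real).
           \<exists>V. projective_variety V \<and> variety_dim V = enat (CARD('n) - 5) \<and>
               V \<subseteq> proj_point ` Sigma_sing (scale_params t c)"
proof -
  have minor: "c i k j * c j l i \<noteq> c j k i * c i l j" if "k \<noteq> l" "k \<notin> {i, j}" "l \<notin> {i, j}" for k l
    using assms(4) that by blast
  \<comment> \<open>A solution of the off-diagonal equations at \<open>t = 0\<close> without zero coordinates; this needs three indices besides \<open>i, j\<close>.\<close>
  define Q where "Q = UNIV - {i, j}"
  have card_Q: "card Q = CARD('n) - 2" using \<open>i \<noteq> j\<close> by (simp add: Q_def card_Diff_subset)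
  obtain y where y: "\<And>p. p \<notin> Q \<Longrightarrow> y $ p = 0" "\<And>p. p \<in> Q \<Longrightarrow> y $ p \<noteq> 0"
    "(\<Sum>p\<in>Q. c i p j * y $ p) = 0" "(\<Sum>p\<in>Q. c j p i * y $ p) = 0"
  proof (rule generic_common_zero[of Q "\<lambda>p. c i p j" "\<lambda>p. c j p i"])
    show "3 \<le> card Q" using assms(1) card_Q by linarith
    show "c i k j * c j l i \<noteq> c j k i * c i l j" if "k \<in> Q" "l \<in> Q" "k \<noteq> l" for k l
      using minor that by (simp add: Q_def)
  qed (rule that)
  have off: "off_diagonal c y p q = (\<Sum>k\<in>Q. c p k q * y $ k)" if "q \<in> {i, j}" for p q
    unfolding off_diagonal_def
    by (rule sum.mono_neutral_right) (use that y(1) in \<open>auto simp: Q_def\<close>)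
  have "2 \<le> card Q" using assms(1) card_Q by linarith
  then obtain T where T: "T \<subseteq> Q" "card T = 2" by (rule obtain_subset_with_card_n)
  \<comment> \<open>The choice of \<open>k\<close> and \<open>l\<close> does not matter, as all minors are nonzero.\<close>
  then obtain k l where "T = {k, l}" "k \<noteq> l" by (auto simp: card_2_iff)
  with T have kl: "k \<noteq> l" "k \<notin> {i, j}" "l \<notin> {i, j}" by (auto simp: Q_def)
  interpret generic_point c i j k l y
    using \<open>i \<noteq> j\<close> kl minor[OF kl] y off by unfold_locales (auto simp: Q_def)
  let ?S = "UNIV - {i, j, k, l}"
  have "card {i, j, k, l} = 4" using \<open>i \<noteq> j\<close> kl by (auto simp: card_insert_if)
  then have card_S: "card ?S = Suc (CARD('n) - 5)"
    using assms(1) card_Diff_subset[of "{i, j, k, l}" UNIV] by simp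
  then obtain q where "q \<in> ?S" by (metis card_eq_0_iff ex_in_conv nat.distinct(1))
  then have "\<forall>\<^sub>F t in at_right 0. covers ?S (singular_locus (scale_params t c))"
    by (intro eventually_covers_singular_locus) simp
  then show ?thesis
  proof (rule eventually_mono)
    fix t
    assume "covers ?S (singular_locus (scale_params t c))"
    from covers_imp_irreducible_chain[OF zariski_closed_singular_locus this card_S]
    obtain C where "irreducible_chain (CARD('n) - 5) (singular_locus (scale_params t c)) C" by blast
    then obtain V where "projective_variety V" "V \<subseteq> singular_locus (scale_params t c)"
      "variety_dim V = enat (CARD('n) - 5)"
      using exact_dimension_subvariety[OF zariski_closed_singular_locus] by metis
    then show "\<exists>V. projective_variety V \<and> variety_dim V = enat (CARD('n) - 5) \<and>
        V \<subseteq> proj_point ` Sigma_sing (scale_params t c)"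
      using singular_locus_subset by blast
  qed
qed

end
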